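(* Let $\Delta$ be a boolean cell complex whose $h$-vector is nonnegative and symmetric. Then the $h$-vector of the barycentric subdivision $\mathrm{sd}(\Delta)$ is symmetric, and the $\gamma$-vector of $\mathrm{sd}(\Delta)$ is the $f$-vector of a balanced simplicial complex.
   Context: A boolean cell complex is a regular cell complex (faces partially ordered by $F\le G$ iff $F$ lies in the closure of $G$, with the empty face below every face) in which every lower interval $[\emptyset,F]$ is isomorphic to a boolean lattice. The barycentric subdivision $\mathrm{sd}(\Delta)$ is the simplicial complex whose vertices are the nonempty faces of $\Delta$ and whose faces are the chains $F_0<F_1<\cdots<F_i$ of nonempty faces. For a $(d-1)$-dimensional complex, $f(\Delta;t)=\sum_{F\in\Delta}t^{1+\dim F}=\sum_{i=0}^d f_i t^i$ (so $f_0=1$ counts the empty face), and the $h$-vector $(h_0,\dots,h_d)$ is defined by $\sum_i h_i t^i=(1-t)^d f(\Delta;t/(1-t))$. The $h$-vector is symmetric if $h_i=h_{d-i}$ for all $i$; then one writes uniquely $\sum_i h_it^i=\sum_{i=0}^{\lfloor d/2\rfloor}\gamma_i t^i(1+t)^{d-2i}$, and $(\gamma_0,\dots,\gamma_{\lfloor d/2\rfloor})$ is the $\gamma$-vector. A $(d-1)$-dimensional simplicial complex is balanced if its vertices can be colored with $d$ colors so that every face has distinctly colored vertices. The $f$-vector of a simplicial complex is $(f_0,f_1,\dots)$ with $f_i$ the number of faces with $i$ vertices, $f_0=1$. *)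

theory Defs
  imports "HOL-Analysis.Abstract_Euclidean_Space" "HOL-Computational_Algebra.Polynomial"
begin

definition closed_unit_ball :: "nat \<Rightarrow> (nat \<Rightarrow> real) set" where
  "closed_unit_ball n = {x \<in> topspace (Euclidean_space n). (\<Sum>i<n. (x i)\<^sup>2) \<le> 1}"

definition open_unit_ball :: "nat \<Rightarrow> (nat \<Rightarrow> real) set" where
  "open_unit_ball n = {x \<in> topspace (Euclidean_space n). (\<Sum>i<n. (x i)\<^sup>2) < 1}"

text \<open>
  A cell is represented by its set of interior points: its closure is a closed \<open>n\<close>-ball,
  in such a way that the cell itself corresponds to the open ball.
\<close>

definition is_cell :: "'a topology \<Rightarrow> nat \<Rightarrow> 'a set \<Rightarrow> bool" where
  "is_cell X n e \<longleftrightarrow> e \<subseteq> topspace X \<and>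
     (\<exists>\<phi>. homeomorphic_map (subtopology (Euclidean_space n) (closed_unit_ball n))
                           (subtopology X (X closure_of e)) \<phi> \<and>
          \<phi> ` open_unit_ball n = e)"

text \<open>The dimension is unique by invariance of dimension.\<close>

definition cell_dim :: "'a topology \<Rightarrow> 'a set \<Rightarrow> nat" where
  "cell_dim X e = (THE n. is_cell X n e)"

text \<open>
  Finite regular cell complexes: the space is Hausdorff, partitioned by finitely many open cells
  whose closures are balls, and the boundary sphere of every cell is a union of cells.
\<close>

definition regular_cell_complex :: "'a topology \<Rightarrow> 'a set set \<Rightarrow> bool" where
  "regular_cell_complex X C \<longleftrightarrow>
     Hausdorff_space X \<and> finite C \<and>
     \<Union>C = topspace X \<and> disjoint C \<and>
     (\<forall>e\<in>C. \<exists>n. is_cell X n e) \<and>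
     (\<forall>e\<in>C. \<exists>B\<subseteq>C. X closure_of e - e = \<Union>B)"

text \<open>
  The empty face is the empty set of points. Since cells are nonempty it is not itself
  a cell, and it lies below every face in \<open>face_le\<close>.
\<close>

definition faces :: "'a set set \<Rightarrow> 'a set set" where
  "faces C = insert {} C"

definition face_le :: "'a topology \<Rightarrow> 'a set \<Rightarrow> 'a set \<Rightarrow> bool" where
  "face_le X F G \<longleftrightarrow> F \<subseteq> X closure_of G"

text \<open>The number \<open>1 + dim F\<close>, where the empty face has dimension \<open>-1\<close>.\<close>

definition face_rank :: "'a topology \<Rightarrow> 'a set \<Rightarrow> nat" where
  "face_rank X F = (if F = {} then 0 else 1 + cell_dim X F)"

definition is_boolean_lattice :: "'b set \<Rightarrow> ('b \<Rightarrow> 'b \<Rightarrow> bool) \<Rightarrow> bool" where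
  "is_boolean_lattice P le \<longleftrightarrow>
     (\<exists>(S :: nat set) \<psi>. finite S \<and> bij_betw \<psi> P (Pow S) \<and>
        (\<forall>x\<in>P. \<forall>y\<in>P. le x y \<longleftrightarrow> \<psi> x \<subseteq> \<psi> y))"

definition boolean_cell_complex :: "'a topology \<Rightarrow> 'a set set \<Rightarrow> bool" where
  "boolean_cell_complex X C \<longleftrightarrow>
     regular_cell_complex X C \<and>
     (\<forall>F\<in>faces C. is_boolean_lattice {G \<in> faces C. face_le X G F} (face_le X))"

text \<open>
  Finite abstract simplicial complexes, given by their faces as sets of vertices; the empty face
  is always present. A face \<open>S\<close> has dimension \<open>card S - 1\<close>.
\<close>

definition abstract_simplicial_complex :: "'v set set \<Rightarrow> bool" where
  "abstract_simplicial_complex K \<longleftrightarrow>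
     finite K \<and> K \<noteq> {} \<and> (\<forall>S\<in>K. finite S) \<and> (\<forall>S\<in>K. \<forall>T\<subseteq>S. T \<in> K)"

text \<open>The vertices are the cells, i.e. the nonempty faces.\<close>

definition barycentric_subdivision :: "'a topology \<Rightarrow> 'a set set \<Rightarrow> 'a set set set" where
  "barycentric_subdivision X C =
     {S. S \<subseteq> C \<and> finite S \<and> (\<forall>F\<in>S. \<forall>G\<in>S. face_le X F G \<or> face_le X G F)}"

text \<open>
  The following notions are shared by cell complexes and simplicial complexes. The argument \<open>D\<close> is
  the set of all faces, including the empty one, and \<open>\<rho> F = 1 + dim F\<close>; for a cell complex one takes
  \<open>\<rho> = face_rank X\<close>, for a simplicial complex \<open>\<rho> = card\<close>. The complex is \<open>(d - 1)\<close>-dimensional for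
  \<open>d = size_of \<rho> D\<close>.
\<close>

definition size_of :: "('b \<Rightarrow> nat) \<Rightarrow> 'b set \<Rightarrow> nat" where
  "size_of \<rho> D = Max (\<rho> ` D)"

definition f_vec :: "('b \<Rightarrow> nat) \<Rightarrow> 'b set \<Rightarrow> nat \<Rightarrow> nat" where
  "f_vec \<rho> D i = card {F \<in> D. \<rho> F = i}"

definition f_poly :: "('b \<Rightarrow> nat) \<Rightarrow> 'b set \<Rightarrow> real poly" where
  "f_poly \<rho> D = (\<Sum>F\<in>D. monom 1 (\<rho> F))"

text \<open>\<open>h(t) = (1 - t)\<^sup>d f(t / (1 - t))\<close>; see \<open>h_poly_char\<close> and \<open>h_poly_eq\<close> below.\<close>

definition h_poly :: "('b \<Rightarrow> nat) \<Rightarrow> 'b set \<Rightarrow> real poly" where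
  "h_poly \<rho> D =
     (THE h. \<forall>t. t \<noteq> 1 \<longrightarrow> poly h t = (1 - t) ^ size_of \<rho> D * poly (f_poly \<rho> D) (t / (1 - t)))"

definition h_vec :: "('b \<Rightarrow> nat) \<Rightarrow> 'b set \<Rightarrow> nat \<Rightarrow> real" where
  "h_vec \<rho> D i = coeff (h_poly \<rho> D) i"

definition h_symmetric :: "('b \<Rightarrow> nat) \<Rightarrow> 'b set \<Rightarrow> bool" where
  "h_symmetric \<rho> D \<longleftrightarrow> (\<forall>i\<le>size_of \<rho> D. h_vec \<rho> D i = h_vec \<rho> D (size_of \<rho> D - i))"

definition gamma_expansion :: "nat \<Rightarrow> (nat \<Rightarrow> real) \<Rightarrow> real poly" where
  "gamma_expansion d g = (\<Sum>i\<le>d div 2. smult (g i) (monom 1 i * [:1, 1:] ^ (d - 2 * i)))"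

text \<open>
  The \<open>\<gamma>\<close>-vector, extended by zeros beyond index \<open>d div 2\<close>. It is meaningful only if the
  \<open>h\<close>-vector is symmetric; see \<open>gamma_expansion_ex1\<close> below.
\<close>

definition gamma_vec :: "('b \<Rightarrow> nat) \<Rightarrow> 'b set \<Rightarrow> nat \<Rightarrow> real" where
  "gamma_vec \<rho> D =
     (THE g. (\<forall>i > size_of \<rho> D div 2. g i = 0) \<and>
             h_poly \<rho> D = gamma_expansion (size_of \<rho> D) g)"

definition balanced :: "'v set set \<Rightarrow> bool" where
  "balanced K \<longleftrightarrow>
     (\<exists>c :: 'v \<Rightarrow> nat. (\<forall>v\<in>\<Union>K. c v < size_of card K) \<and> (\<forall>S\<in>K. inj_on c S))"

lemma poly_eqI_except_one:
  fixes p q :: "real poly"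
  assumes "\<And>t. t \<noteq> 1 \<Longrightarrow> poly p t = poly q t"
  shows "p = q"
proof (rule ccontr)
  assume "p \<noteq> q"
  then have "finite {t. poly (p - q) t = 0}"
    using poly_roots_finite[of "p - q"] by simp
  moreover have "- {1} \<subseteq> {t. poly (p - q) t = 0}"
    using assms by auto
  ultimately have "finite (- {1::real})"
    by (rule rev_finite_subset)
  then show False
    using infinite_UNIV_char_0[where 'a = real]
    by (simp add: Compl_eq_Diff_UNIV)
qed

lemma poly_h_sum:
  assumes "finite D" "t \<noteq> 1"
  shows "poly (\<Sum>F\<in>D. monom 1 (\<rho> F) * [:1, -1:] ^ (size_of \<rho> D - \<rho> F)) t =
         (1 - t) ^ size_of \<rho> D * poly (f_poly \<rho> D) (t / (1 - t))"
proof -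
  have "t ^ \<rho> F * (1 - t) ^ (size_of \<rho> D - \<rho> F) = (1 - t) ^ size_of \<rho> D * (t / (1 - t)) ^ \<rho> F"
    if "F \<in> D" for F
  proof -
    have "\<rho> F \<le> size_of \<rho> D"
      unfolding size_of_def using assms that by simp
    then have "(1 - t) ^ size_of \<rho> D = (1 - t) ^ (size_of \<rho> D - \<rho> F) * (1 - t) ^ \<rho> F"
      by (simp flip: power_add)
    then show ?thesis
      using assms by (simp add: power_divide)
  qed
  then show ?thesis
    by (simp add: f_poly_def poly_sum poly_monom sum_distrib_left)
qed

lemma h_poly_eq:
  assumes "finite D"
  shows "h_poly \<rho> D = (\<Sum>F\<in>D. monom 1 (\<rho> F) * [:1, -1:] ^ (size_of \<rho> D - \<rho> F))"
  unfolding h_poly_def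
  by (rule the_equality) (auto intro!: poly_eqI_except_one simp: poly_h_sum assms)

lemma h_poly_char:
  assumes "finite D" "t \<noteq> 1"
  shows "poly (h_poly \<rho> D) t = (1 - t) ^ size_of \<rho> D * poly (f_poly \<rho> D) (t / (1 - t))"
  using assms by (simp add: h_poly_eq poly_h_sum)

lemma gamma_expansion_Suc_Suc:
  "gamma_expansion (Suc (Suc d)) g =
     smult (g 0) ([:1, 1:] ^ Suc (Suc d)) + pCons 0 (gamma_expansion d (\<lambda>i. g (Suc i)))"
proof -
  have "pCons 0 (sum f A) = (\<Sum>i\<in>A. pCons 0 (f i))" for f :: "nat \<Rightarrow> real poly" and A
    by (induction A rule: infinite_finite_induct) (auto, metis add_0 add_pCons)
  then show ?thesis
    by (simp add: gamma_expansion_def sum.atMost_Suc_shift monom_Suc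
             del: power_Suc sum.atMost_Suc)
qed

lemma coeff_one_plus_X_power: "coeff ([:1, 1:] ^ n) i = (of_nat (n choose i) :: real)"
proof (induction n arbitrary: i)
  case 0
  then show ?case by (cases i) auto
next
  case (Suc n)
  then show ?case by (cases i) (auto simp: coeff_pCons)
qed

lemma gamma_expansion_ex1:
  fixes p :: "real poly"
  assumes "degree p \<le> d" and "\<And>i. i \<le> d \<Longrightarrow> coeff p i = coeff p (d - i)"
  shows "\<exists>!g. (\<forall>i > d div 2. g i = 0) \<and> p = gamma_expansion d g"
  using assms
proof (induction d arbitrary: p rule: induct_nat_012)
  case 0
  have *: "p = gamma_expansion 0 g \<longleftrightarrow> g 0 = coeff p 0" for g
    using 0 by (auto simp: gamma_expansion_def one_pCons elim!: degree_eq_zeroE)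
  show ?case
    unfolding * by (intro ex1I[of _ "\<lambda>i. if i = 0 then coeff p 0 else 0"]) auto
next
  case 1
  have "p = [:coeff p 0, coeff p 0:]"
    using 1(1) 1(2)[of 0]
    by (intro poly_eqI) (auto simp: coeff_pCons coeff_eq_0 split: nat.splits)
  then have *: "p = gamma_expansion (Suc 0) g \<longleftrightarrow> g 0 = coeff p 0" for g
    by (auto simp: gamma_expansion_def)
  show ?case
    unfolding * by (intro ex1I[of _ "\<lambda>i. if i = 0 then coeff p 0 else 0"]) auto
next
  case (ge2 d)
  let ?B = "[:1, 1:] ^ Suc (Suc d) :: real poly"
  obtain a q where aq: "p - smult (coeff p 0) ?B = pCons a q"
    by (rule pCons_cases)
  have cB: "coeff ?B i = of_nat (Suc (Suc d) choose i)" for i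
    by (rule coeff_one_plus_X_power)
  have "a = coeff (p - smult (coeff p 0) ?B) 0"
    unfolding aq by simp
  then have a: "a = 0"
    by (simp only: coeff_diff coeff_smult cB) simp
  have cq: "coeff q i = coeff p (Suc i) - coeff p 0 * of_nat (Suc (Suc d) choose Suc i)" for i
  proof -
    have "coeff q i = coeff (p - smult (coeff p 0) ?B) (Suc i)"
      unfolding aq by simp
    then show ?thesis
      by (simp only: coeff_diff coeff_smult cB)
  qed
  have top: "coeff p (Suc (Suc d)) = coeff p 0"
    using ge2.prems(2)[of 0] by simp
  have "degree q \<le> d"
  proof (rule degree_le, intro allI impI)
    fix i assume "d < i"
    then consider "i = Suc d" | "Suc d < i"
      by linarith
    then show "coeff q i = 0"
    proof cases
      case 1
      then show ?thesis by (simp only: cq top) simp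
    next
      case 2
      then have "coeff p (Suc i) = 0"
        using ge2.prems(1) by (intro coeff_eq_0) simp
      with 2 show ?thesis by (simp only: cq) (simp add: binomial_eq_0)
    qed
  qed
  moreover have "coeff q i = coeff q (d - i)" if "i \<le> d" for i
  proof -
    have "Suc (Suc d) - Suc i = Suc (d - i)"
      using that by simp
    then show ?thesis
      using that ge2.prems(2)[of "Suc i"] binomial_symmetric[of "Suc i" "Suc (Suc d)"]
      by (simp only: cq)
  qed
  ultimately have ex1: "\<exists>!g. (\<forall>i > d div 2. g i = 0) \<and> q = gamma_expansion d g"
    by (rule ge2.IH(1))
  have p: "p = smult (coeff p 0) ?B + pCons 0 q"
    using aq a by (simp only: diff_eq_eq add.commute)
  have iff: "p = gamma_expansion (Suc (Suc d)) g \<longleftrightarrow>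
      g 0 = coeff p 0 \<and> q = gamma_expansion d (\<lambda>i. g (Suc i))" for g
  proof
    assume *: "p = gamma_expansion (Suc (Suc d)) g"
    have "coeff p 0 = g 0 * coeff ?B 0"
      by (simp only: * gamma_expansion_Suc_Suc coeff_add coeff_smult coeff_pCons_0 add_0_right)
    then have g0: "g 0 = coeff p 0"
      by (simp only: cB) simp
    have "smult (coeff p 0) ?B + pCons 0 q =
          smult (coeff p 0) ?B + pCons 0 (gamma_expansion d (\<lambda>i. g (Suc i)))"
      using * p g0 by (simp only: gamma_expansion_Suc_Suc)
    then show "g 0 = coeff p 0 \<and> q = gamma_expansion d (\<lambda>i. g (Suc i))"
      using g0 by (simp only: add_left_cancel pCons_eq_iff simp_thms)
  next
    assume *: "g 0 = coeff p 0 \<and> q = gamma_expansion d (\<lambda>i. g (Suc i))"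
    then show "p = gamma_expansion (Suc (Suc d)) g"
      using p by (simp only: gamma_expansion_Suc_Suc)
  qed
  from ex1 obtain g where g: "\<forall>i > d div 2. g i = 0" "q = gamma_expansion d g"
    and uniq: "\<And>g'. \<lbrakk>\<forall>i > d div 2. g' i = 0; q = gamma_expansion d g'\<rbrakk> \<Longrightarrow> g' = g"
    by blast
  show ?case
  proof (rule ex1I[of _ "case_nat (coeff p 0) g"], intro conjI)
    show "\<forall>i > Suc (Suc d) div 2. case_nat (coeff p 0) g i = 0"
      using g(1) by (auto split: nat.split)
    show "p = gamma_expansion (Suc (Suc d)) (case_nat (coeff p 0) g)"
      using g(2) by (subst iff) simp
  next
    fix g' assume g': "(\<forall>i > Suc (Suc d) div 2. g' i = 0) \<and> p = gamma_expansion (Suc (Suc d)) g'"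
    then have *: "g' 0 = coeff p 0" "q = gamma_expansion d (\<lambda>i. g' (Suc i))"
      using iff by blast+
    have "(\<lambda>i. g' (Suc i)) = g"
      using g' * by (intro uniq) auto
    with * show "g' = case_nat (coeff p 0) g"
      by (auto split: nat.split)
  qed
qed

end

theory Submission
  imports Defs "HOL-Homology.Invariance_of_Domain" "HOL-Library.Nat_Bijection"
begin

text \<open>
  Let \<open>E d j\<close> enumerate the permutations of \<open>{1..d + 1}\<close> with first letter \<open>j + 1\<close> by descents.
  Invariance of domain identifies the dimension of a cell with its rank in the boolean face poset,
  so the chains below a face are counted by its rank alone, and this gives the formula
  \<open>h(sd \<Delta>) = (\<Sum>j\<le>d. h\<^sub>j(\<Delta>) * E d j)\<close> of Brenti and Welker.

  By symmetry of \<open>h(\<Delta>)\<close> the sum is a nonnegative combination of the palindromic polynomials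
  \<open>E d j + E d (d - j)\<close>. Removing the first letter of a permutation gives a recursion that relates
  them to the palindromic polynomials \<open>t * E d j + E d (d - j)\<close>. In terms of \<open>\<gamma>\<close>-vectors the recursion
  is subtraction-free and can be realized by simplicial complexes: for \<open>j = 0\<close> one obtains the
  \<open>f\<close>-vector of a balanced complex, and for \<open>j \<ge> 1\<close> one obtains \<open>x\<close> times a sum of \<open>f\<close>-polynomials of
  subcomplexes of it, where \<open>x = t / (1 + t)\<^sup>2\<close>. Since \<open>h\<^sub>0 = 1\<close>, attaching \<open>h\<^sub>j\<close> copies of the cones
  over these subcomplexes, with new apexes, produces the required complex.
\<close>

hide_const (open) up_ring.coeff up_ring.monom Module.smult

section \<open>Dimensions of cells\<close>

lemma topspace_closed_unit_ball:
  "topspace (subtopology (Euclidean_space n) (closed_unit_ball n)) = closed_unit_ball n"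
  by (auto simp: closed_unit_ball_def)

lemma continuous_map_coordinate:
  "continuous_map (Euclidean_space n) euclideanreal (\<lambda>x. x i)"
  unfolding Euclidean_space_def
  by (intro continuous_map_from_subtopology continuous_map_product_projection) auto

lemma openin_open_unit_ball: "openin (Euclidean_space n) (open_unit_ball n)"
proof -
  have "continuous_map (Euclidean_space n) euclideanreal (\<lambda>x. \<Sum>i<n. (x i)\<^sup>2)"
    by (intro continuous_intros continuous_map_coordinate) auto
  then have "openin (Euclidean_space n)
      {x \<in> topspace (Euclidean_space n). (\<Sum>i<n. (x i)\<^sup>2) \<in> {..<1}}"
    by (rule openin_continuous_map_preimage) auto
  then show ?thesis
    by (simp add: open_unit_ball_def)
qed

lemma open_unit_ball_subset: "open_unit_ball n \<subseteq> closed_unit_ball n"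
  by (auto simp: open_unit_ball_def closed_unit_ball_def)

lemma zero_in_open_unit_ball: "(\<lambda>_. 0) \<in> open_unit_ball n"
  by (simp add: open_unit_ball_def topspace_Euclidean_space)

section \<open>Embeddings excluded by invariance of domain\<close>

lemma openin_Euclidean_space_line:
  assumes V: "openin (Euclidean_space k) V" and y: "y \<in> V" and w: "w \<in> topspace (Euclidean_space k)"
  obtains r where "r > 0" "(\<lambda>i. y i + r * w i) \<in> V"
proof -
  have yk: "y \<in> topspace (Euclidean_space k)"
    using V y openin_subset by blast
  \<comment> \<open>The truncated form is the one to which the componentwise continuity criterion
    applies; both points vanish from coordinate \<open>k\<close> on.\<close>
  have eq: "(\<lambda>r i. if i < k then y i + r * w i else 0) = (\<lambda>r i. y i + r * w i)"
    using yk w by (auto simp: topspace_Euclidean_space fun_eq_iff)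
  have "continuous_map euclideanreal (Euclidean_space k) (\<lambda>r i. if i < k then y i + r * w i else 0)"
    unfolding continuous_map_componentwise_Euclidean_space
    by (auto intro!: continuous_intros)
  then have "continuous_map euclideanreal (Euclidean_space k) (\<lambda>r i. y i + r * w i)"
    unfolding eq .
  then have "open {r. (\<lambda>i. y i + r * w i) \<in> V}" (is "open ?R")
    using openin_continuous_map_preimage[OF _ V] by fastforce
  moreover have "0 \<in> ?R"
    using y by simp
  ultimately obtain e where e: "e > 0" "ball 0 e \<subseteq> ?R"
    by (meson open_contains_ball)
  then have "e / 2 \<in> ?R"
    by (intro subsetD[OF e(2)]) auto
  then show thesis
    using e that[of "e / 2"] by auto
qed

text \<open>The image of \<open>f\<close> is open by invariance of domain, so it contains a point
  displaced from \<open>f x\<close> in direction \<open>j\<close>, where the coordinate is no longer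
  zero.\<close>

lemma no_injection_into_hyperplane:
  assumes U: "openin (Euclidean_space k) U" "U \<noteq> {}"
    and f: "continuous_map (subtopology (Euclidean_space k) U) (Euclidean_space k) f" "inj_on f U"
    and j: "j < k" and zero: "\<And>x. x \<in> U \<Longrightarrow> f x j = 0"
  shows False
proof -
  have op: "openin (Euclidean_space k) (f ` U)"
    by (rule invariance_of_domain_Euclidean_space[OF U(1) f])
  obtain x where x: "x \<in> U"
    using U(2) by blast
  have "(\<lambda>i. if i = j then 1 else 0) \<in> topspace (Euclidean_space k)"
    using j by (auto simp: topspace_Euclidean_space)
  then obtain r :: real where "r > 0" "(\<lambda>i. f x i + r * (if i = j then 1 else 0)) \<in> f ` U"
    using openin_Euclidean_space_line[OF op imageI[OF x]] by blast
  then obtain z where "z \<in> U" "f z = (\<lambda>i. f x i + r * (if i = j then 1 else 0))"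
    by auto
  then have "f z j = f x j + r"
    by simp
  then show False
    using zero \<open>z \<in> U\<close> x \<open>r > 0\<close> by simp
qed

text \<open>Here the displacement is radial: an open image also contains some
  \<open>(1 + r) * f x\<close> with \<open>r > 0\<close>, which has norm greater than one.\<close>

lemma no_injection_into_sphere:
  assumes U: "openin (Euclidean_space k) U" "U \<noteq> {}"
    and f: "continuous_map (subtopology (Euclidean_space k) U) (Euclidean_space k) f" "inj_on f U"
    and sphere: "\<And>x. x \<in> U \<Longrightarrow> (\<Sum>i<k. (f x i)\<^sup>2) = 1"
  shows False
proof -
  have op: "openin (Euclidean_space k) (f ` U)"
    by (rule invariance_of_domain_Euclidean_space[OF U(1) f])
  obtain x where x: "x \<in> U"
    using U(2) by blast
  then have "f x \<in> topspace (Euclidean_space k)"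
    using op openin_subset by blast
  then obtain r :: real where r: "r > 0" "(\<lambda>i. f x i + r * f x i) \<in> f ` U"
    using openin_Euclidean_space_line[OF op imageI[OF x]] by blast
  then obtain z where z: "z \<in> U" "f z = (\<lambda>i. f x i + r * f x i)"
    by auto
  have "1 = (\<Sum>i<k. (f z i)\<^sup>2)"
    using sphere z(1) by simp
  also have "\<dots> = (1 + r)\<^sup>2 * (\<Sum>i<k. (f x i)\<^sup>2)"
    unfolding z(2) sum_distrib_left
    by (intro sum.cong) (auto simp: power2_eq_square algebra_simps)
  also have "\<dots> = (1 + r)\<^sup>2"
    using sphere x by simp
  finally show False
    using r(1) by (simp add: power2_eq_square algebra_simps add_pos_pos)
      (smt (verit) mult_pos_pos)
qed

text \<open>Induction on the closed sets: if \<open>U\<close> is not contained in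
  \<open>K j\<close>, then \<open>U - K j\<close> is a nonempty open set covered by the remaining
  ones.\<close>

lemma finite_closed_cover_interior:
  assumes "finite I" "openin T U" "U \<noteq> {}" "U \<subseteq> (\<Union>i\<in>I. K i)" "\<And>i. i \<in> I \<Longrightarrow> closedin T (K i)"
  obtains i V where "i \<in> I" "openin T V" "V \<noteq> {}" "V \<subseteq> U" "V \<subseteq> K i"
  using assms
proof (induction I arbitrary: U thesis rule: finite_induct)
  case empty
  then show ?case by auto
next
  case (insert j I)
  show ?case
  proof (cases "U \<subseteq> K j")
    case True
    then show ?thesis
      using insert.prems(1)[of j U] insert.prems(2,3) by blast
  next
    case False
    have "openin T (U - K j)"
      using insert.prems by (intro openin_diff) auto
    moreover have "U - K j \<noteq> {}"
      using False by blast
    moreover have "U - K j \<subseteq> (\<Union>i\<in>I. K i)"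
      using insert.prems(4) by auto
    ultimately obtain i V where "i \<in> I" "openin T V" "V \<noteq> {}" "V \<subseteq> U - K j" "V \<subseteq> K i"
      using insert.IH[of "U - K j"] insert.prems(5) by (metis insertCI)
    then show ?thesis
      using insert.prems(1)[of i V] by blast
  qed
qed

section \<open>Charts and dimensions of the cells in a closure\<close>

lemma is_cell_charts:
  assumes "is_cell X n e"
  obtains \<phi> \<psi> where
    "continuous_map (subtopology (Euclidean_space n) (closed_unit_ball n))
       (subtopology X (X closure_of e)) \<phi>"
    "continuous_map (subtopology X (X closure_of e)) (Euclidean_space n) \<psi>"
    "\<And>x. x \<in> closed_unit_ball n \<Longrightarrow> \<phi> x \<in> X closure_of e \<and> \<psi> (\<phi> x) = x"
    "\<And>z. z \<in> X closure_of e \<Longrightarrow> \<psi> z \<in> closed_unit_ball n \<and> \<phi> (\<psi> z) = z"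
    "\<phi> ` open_unit_ball n = e"
proof -
  obtain \<phi> where \<phi>: "homeomorphic_map (subtopology (Euclidean_space n) (closed_unit_ball n))
                           (subtopology X (X closure_of e)) \<phi>" "\<phi> ` open_unit_ball n = e"
    using assms unfolding is_cell_def by blast
  then obtain \<psi> where \<psi>: "homeomorphic_maps (subtopology (Euclidean_space n) (closed_unit_ball n))
                           (subtopology X (X closure_of e)) \<phi> \<psi>"
    using homeomorphic_map_maps by blast
  have cl: "topspace (subtopology X (X closure_of e)) = X closure_of e"
    using closure_of_subset_topspace by fastforce
  have c: "continuous_map (subtopology (Euclidean_space n) (closed_unit_ball n))
                           (subtopology X (X closure_of e)) \<phi>"
     "continuous_map (subtopology X (X closure_of e)) 
       (subtopology (Euclidean_space n) (closed_unit_ball n)) \<psi>"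
    using \<psi> unfolding homeomorphic_maps_def by auto
  show thesis
  proof
    show "continuous_map (subtopology X (X closure_of e)) (Euclidean_space n) \<psi>"
      using c(2) continuous_map_in_subtopology by blast
    show "\<phi> x \<in> X closure_of e \<and> \<psi> (\<phi> x) = x" if "x \<in> closed_unit_ball n" for x
      using c(1) \<psi> that unfolding homeomorphic_maps_def continuous_map_def cl topspace_closed_unit_ball
      by auto
    show "\<psi> z \<in> closed_unit_ball n \<and> \<phi> (\<psi> z) = z" if "z \<in> X closure_of e" for z
      using c(2) \<psi> that unfolding homeomorphic_maps_def continuous_map_def cl topspace_closed_unit_ball
      by auto
  qed (use c \<phi> in auto)
qed

lemma is_cell_nonempty: "is_cell X n e \<Longrightarrow> e \<noteq> {}"
  unfolding is_cell_def using zero_in_open_unit_ball by blast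

lemma is_cell_subset_closure: "is_cell X n e \<Longrightarrow> e \<subseteq> X closure_of e"
  unfolding is_cell_def by (simp add: closure_of_subset)

text \<open>\<open>f\<close> is the chart of \<open>G\<close> followed by the inverse chart of
  \<open>e\<close>. It turns an incidence of cells into an injection between Euclidean spaces, where
  invariance of domain applies.\<close>

lemma is_cell_transition:
  assumes G: "is_cell X k G" and e: "is_cell X n e" and le: "G \<subseteq> X closure_of e"
  obtains f \<phi> where "continuous_map (subtopology (Euclidean_space k) (open_unit_ball k)) (Euclidean_space n) f"
    "inj_on f (open_unit_ball k)" "f ` open_unit_ball k \<subseteq> closed_unit_ball n"
    "\<phi> ` open_unit_ball n = e" "\<And>x. x \<in> open_unit_ball k \<Longrightarrow> \<phi> (f x) \<in> G"
proof -
  obtain \<phi> \<psi> where e':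
    "continuous_map (subtopology X (X closure_of e)) (Euclidean_space n) \<psi>"
    "\<And>z. z \<in> X closure_of e \<Longrightarrow> \<psi> z \<in> closed_unit_ball n \<and> \<phi> (\<psi> z) = z"
    "\<phi> ` open_unit_ball n = e"
    using is_cell_charts[OF e] by metis
  obtain \<phi>' \<psi>' where G':
    "continuous_map (subtopology (Euclidean_space k) (closed_unit_ball k))
       (subtopology X (X closure_of G)) \<phi>'"
    "\<And>x. x \<in> closed_unit_ball k \<Longrightarrow> \<phi>' x \<in> X closure_of G \<and> \<psi>' (\<phi>' x) = x"
    "\<phi>' ` open_unit_ball k = G"
    using is_cell_charts[OF G] by metis
  have in_cl: "\<phi>' x \<in> X closure_of e" if "x \<in> open_unit_ball k" for x
    using G'(3) le that by blast
  show thesis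
  proof (rule that)
    have "continuous_map (subtopology (Euclidean_space k) (closed_unit_ball k)) X \<phi>'"
      using G'(1) continuous_map_in_subtopology by blast
    then have "continuous_map (subtopology (Euclidean_space k) (open_unit_ball k)) X \<phi>'"
      using open_unit_ball_subset continuous_map_from_subtopology_mono by blast
    then have "continuous_map (subtopology (Euclidean_space k) (open_unit_ball k))
        (subtopology X (X closure_of e)) \<phi>'"
      using in_cl by (auto simp: continuous_map_in_subtopology)
    then show "continuous_map (subtopology (Euclidean_space k) (open_unit_ball k))
        (Euclidean_space n) (\<psi> \<circ> \<phi>')"
      using e'(1) continuous_map_compose by blast
    show "inj_on (\<psi> \<circ> \<phi>') (open_unit_ball k)"
    proof (rule inj_onI)
      fix x y assume xy: "x \<in> open_unit_ball k" "y \<in> open_unit_ball k" "(\<psi> \<circ> \<phi>') x = (\<psi> \<circ> \<phi>') y"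
      then have "\<phi>' x = \<phi>' y"
        using e'(2) in_cl by (metis comp_apply)
      then show "x = y"
        using G'(2) xy open_unit_ball_subset by (metis subsetD)
    qed
    show "(\<psi> \<circ> \<phi>') ` open_unit_ball k \<subseteq> closed_unit_ball n"
      using e'(2) in_cl by auto
    show "\<phi> ` open_unit_ball n = e"
      by fact
    show "\<phi> ((\<psi> \<circ> \<phi>') x) \<in> G" if "x \<in> open_unit_ball k" for x
      using e'(2)[OF in_cl[OF that]] G'(3) that by auto
  qed
qed

lemma continuous_map_Euclidean_space_mono:
  "n \<le> k \<Longrightarrow> continuous_map T (Euclidean_space n) f \<Longrightarrow> continuous_map T (Euclidean_space k) f"
  unfolding Euclidean_space_def continuous_map_in_subtopology by (auto simp: Pi_iff)

text \<open>For \<open>n < k\<close> the transition map of \<open>e\<close> to itself would inject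
  an open \<open>k\<close>-ball into a hyperplane, as points of \<open>Euclidean_space n\<close>
  vanish in coordinate \<open>k - 1\<close>.\<close>

lemma is_cell_dim_le:
  assumes "is_cell X k e" "is_cell X n e"
  shows "k \<le> n"
proof (rule ccontr)
  assume "\<not> k \<le> n"
  obtain f where f: "continuous_map (subtopology (Euclidean_space k) (open_unit_ball k)) (Euclidean_space n) f"
    "inj_on f (open_unit_ball k)" "f ` open_unit_ball k \<subseteq> closed_unit_ball n"
    using is_cell_transition[OF assms is_cell_subset_closure[OF assms(1)]] by metis
  have "continuous_map (subtopology (Euclidean_space k) (open_unit_ball k)) (Euclidean_space k) f"
    using f(1) \<open>\<not> k \<le> n\<close> by (intro continuous_map_Euclidean_space_mono[of n k]) auto
  moreover have "f x (k - 1) = 0" if "x \<in> open_unit_ball k" for x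
  proof -
    have "f x \<in> closed_unit_ball n"
      using f(3) that by blast
    then show ?thesis
      using \<open>\<not> k \<le> n\<close> by (auto simp: closed_unit_ball_def topspace_Euclidean_space)
  qed
  ultimately show False
    using no_injection_into_hyperplane[OF openin_open_unit_ball _ _ f(2), of "k - 1"]
      zero_in_open_unit_ball \<open>\<not> k \<le> n\<close> by (metis diff_less empty_iff less_imp_le_nat
      less_nat_zero_code linorder_not_less nat_neq_iff zero_less_one le0 neq0_conv)
qed

lemma cell_dim_eq: "is_cell X n e \<Longrightarrow> cell_dim X e = n"
  unfolding cell_dim_def using is_cell_dim_le by (metis le_antisym the_equality)

text \<open>Since \<open>G\<close> misses \<open>e\<close>, its transition map avoids the open ball
  and lands in the unit sphere, which excludes \<open>n \<le> k\<close>.\<close>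

lemma boundary_cell_dim_less:
  assumes "is_cell X k G" "is_cell X n e" "G \<subseteq> X closure_of e" "G \<inter> e = {}"
  shows "k < n"
proof (rule ccontr)
  assume "\<not> k < n"
  obtain f \<phi> where f: "continuous_map (subtopology (Euclidean_space k) (open_unit_ball k)) (Euclidean_space n) f"
    "inj_on f (open_unit_ball k)" "f ` open_unit_ball k \<subseteq> closed_unit_ball n"
    "\<phi> ` open_unit_ball n = e" "\<And>x. x \<in> open_unit_ball k \<Longrightarrow> \<phi> (f x) \<in> G"
    using is_cell_transition[OF assms(1-3)] by metis
  have "continuous_map (subtopology (Euclidean_space k) (open_unit_ball k)) (Euclidean_space k) f"
    using f(1) \<open>\<not> k < n\<close> by (intro continuous_map_Euclidean_space_mono[of n k]) auto
  moreover have "(\<Sum>i<k. (f x i)\<^sup>2) = 1" if x: "x \<in> open_unit_ball k" for x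
  proof -
    have fx: "f x \<in> closed_unit_ball n"
      using f(3) x by blast
    moreover have "f x \<notin> open_unit_ball n"
      using f(4) f(5)[OF x] assms(4) by blast
    ultimately have "(\<Sum>i<n. (f x i)\<^sup>2) = 1"
      by (auto simp: closed_unit_ball_def open_unit_ball_def)
    moreover have "(\<Sum>i<n. (f x i)\<^sup>2) = (\<Sum>i<k. (f x i)\<^sup>2)"
      using fx \<open>\<not> k < n\<close> 
      by (intro sum.mono_neutral_left) (auto simp: closed_unit_ball_def topspace_Euclidean_space)
    ultimately show ?thesis
      by simp
  qed
  ultimately show False
    using no_injection_into_sphere[OF openin_open_unit_ball _ _ f(2)] zero_in_open_unit_ball 
    by (metis empty_iff)
qed


text \<open>
  On the punctured space, recording the norm of a point and the chart image of its radial projection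
  to the sphere gives an injection of an open set into dimension \<open>dm G + 1\<close> for some \<open>G\<close>.
\<close>

lemma boundary_cell_dim_ge:
  assumes e: "is_cell X n e" and n: "n > 0" and B: "finite B" "(X closure_of e) - e = \<Union>B"
    and cells: "\<And>G. G \<in> B \<Longrightarrow> is_cell X (dm G) G"
  obtains G where "G \<in> B" "n \<le> Suc (dm G)"
proof (rule ccontr)
  assume "\<not> thesis"
  with that have small: "Suc (dm G) < n" if "G \<in> B" for G
    using \<open>G \<in> B\<close> not_le by blast
  obtain \<phi> \<psi> where c:
    "continuous_map (subtopology (Euclidean_space n) (closed_unit_ball n))
       (subtopology X (X closure_of e)) \<phi>"
    "continuous_map (subtopology X (X closure_of e)) (Euclidean_space n) \<psi>"
    "\<And>x. x \<in> closed_unit_ball n \<Longrightarrow> \<phi> x \<in> X closure_of e \<and> \<psi> (\<phi> x) = x"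
    "\<And>z. z \<in> X closure_of e \<Longrightarrow> \<psi> z \<in> closed_unit_ball n \<and> \<phi> (\<psi> z) = z"
    "\<phi> ` open_unit_ball n = e"
    using is_cell_charts[OF e] by metis
  define nrm :: "(nat \<Rightarrow> real) \<Rightarrow> real" where "nrm y = sqrt (\<Sum>i<n. (y i)\<^sup>2)" for y
  define U where "U = {y \<in> topspace (Euclidean_space n). nrm y \<in> - {0}}"
  define u where "u = (\<lambda>y i. if i < n then y i / nrm y else (0::real))"
  have cont_nrm: "continuous_map (Euclidean_space n) euclideanreal nrm"
    unfolding nrm_def by (intro continuous_intros continuous_map_coordinate) auto
  then have U: "openin (Euclidean_space n) U"
    unfolding U_def by (rule openin_continuous_map_preimage) auto
  then have topU: "topspace (subtopology (Euclidean_space n) U) = U"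
    using openin_subset by fastforce
  have "(\<lambda>i. if i = 0 then 1 else 0) \<in> U"
  proof -
    have "(\<Sum>i<n. ((if i = 0 then 1 else 0 :: real))\<^sup>2) = (\<Sum>i<n. if i = 0 then 1 else 0)"
      by (intro sum.cong) auto
    also have "\<dots> = 1"
      using n by simp
    finally show ?thesis
      using n by (auto simp: U_def nrm_def topspace_Euclidean_space)
  qed
  then have "U \<noteq> {}"
    by blast
  have cont_nrmU: "continuous_map (subtopology (Euclidean_space n) U) euclideanreal nrm"
    using cont_nrm continuous_map_from_subtopology by blast
  have u_sphere: "(\<Sum>i<n. (u y i)\<^sup>2) = 1" "u y \<in> topspace (Euclidean_space n)" if "y \<in> U" for y
  proof -
    have "(\<Sum>i<n. (u y i)\<^sup>2) = (\<Sum>i<n. (y i)\<^sup>2) / (nrm y)\<^sup>2"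
      by (simp add: u_def power_divide sum_divide_distrib)
    also have "(nrm y)\<^sup>2 = (\<Sum>i<n. (y i)\<^sup>2)"
      unfolding nrm_def by (simp add: sum_nonneg)
    finally show "(\<Sum>i<n. (u y i)\<^sup>2) = 1"
      using that by (auto simp: U_def nrm_def)
    show "u y \<in> topspace (Euclidean_space n)"
      by (simp add: u_def topspace_Euclidean_space)
  qed
  then have u_ball: "u y \<in> closed_unit_ball n" "u y \<notin> open_unit_ball n" if "y \<in> U" for y
    using that by (auto simp: closed_unit_ball_def open_unit_ball_def)
  have "continuous_map (subtopology (Euclidean_space n) U) (Euclidean_space n) u"
    unfolding u_def continuous_map_componentwise_Euclidean_space
  proof (intro allI impI)
    show "continuous_map (subtopology (Euclidean_space n) U) euclideanreal (\<lambda>y. y i / nrm y)" for i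
      using cont_nrmU
      by (intro continuous_map_real_divide continuous_map_from_subtopology[OF continuous_map_coordinate])
        (auto simp: topU, auto simp: U_def)
  qed
  then have cont_u: "continuous_map (subtopology (Euclidean_space n) U)
      (subtopology (Euclidean_space n) (closed_unit_ball n)) u"
    using u_ball(1) by (auto simp: continuous_map_in_subtopology topU)
  then have cont_p: "continuous_map (subtopology (Euclidean_space n) U)
      (subtopology X (X closure_of e)) (\<phi> \<circ> u)"
    using c(1) continuous_map_compose by blast
  have p_bd: "\<phi> (u y) \<in> \<Union>B" if "y \<in> U" for y
  proof -
    have "\<phi> (u y) \<notin> e"
    proof
      assume "\<phi> (u y) \<in> e"
      then obtain z where z: "z \<in> open_unit_ball n" "\<phi> (u y) = \<phi> z"
        using c(5) by auto
      then have "u y = z"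
        using c(3) u_ball(1)[OF that] open_unit_ball_subset by (metis subsetD)
      then show False
        using z u_ball(2)[OF that] by simp
    qed
    then show ?thesis
      using c(3)[OF u_ball(1)[OF that]] B(2) by blast
  qed
  \<comment> \<open>Points whose direction is mapped into the closure of \<open>G\<close>. These
    finitely many closed sets cover \<open>U\<close>, so one of them contains a nonempty open set
    \<open>V\<close>.\<close>
  define K where "K G = {y \<in> U. \<phi> (u y) \<in> X closure_of G}" for G
  have cl_sub: "G \<subseteq> X closure_of G" if "G \<in> B" for G
    using cells[OF that] is_cell_subset_closure by blast
  have cover: "U \<subseteq> (\<Union>G\<in>B. K G)"
    using p_bd cl_sub unfolding K_def by blast
  have closed: "closedin (subtopology (Euclidean_space n) U) (K G)" for G
  proof -
    have "continuous_map (subtopology (Euclidean_space n) U) X (\<phi> \<circ> u)"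
      using cont_p continuous_map_in_subtopology by blast
    then have "closedin (subtopology (Euclidean_space n) U)
        {y \<in> topspace (subtopology (Euclidean_space n) U). (\<phi> \<circ> u) y \<in> X closure_of G}"
      by (rule closedin_continuous_map_preimage) simp
    then show ?thesis
      unfolding K_def topU o_def .
  qed
  have "openin (subtopology (Euclidean_space n) U) U"
    using U by (simp add: openin_subtopology_refl openin_subset)
  then obtain G V where GV: "G \<in> B" "openin (subtopology (Euclidean_space n) U) V" "V \<noteq> {}" "V \<subseteq> U" "V \<subseteq> K G"
    using finite_closed_cover_interior[OF B(1) _ \<open>U \<noteq> {}\<close> cover closed] by metis
  have V: "openin (Euclidean_space n) V"
    using GV(2) U openin_trans_full by blast
  then have topV: "topspace (subtopology (Euclidean_space n) V) = V"
    using openin_subset by fastforce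
  let ?k = "dm G"
  obtain \<phi>' \<psi>' where G':
    "continuous_map (subtopology X (X closure_of G)) (Euclidean_space ?k) \<psi>'"
    "\<And>z. z \<in> X closure_of G \<Longrightarrow> \<psi>' z \<in> closed_unit_ball ?k \<and> \<phi>' (\<psi>' z) = z"
    using is_cell_charts[OF cells[OF GV(1)]] by metis
  \<comment> \<open>The first \<open>dm G\<close> coordinates record the direction through the chart
    of \<open>G\<close>, the next one the norm. The outer test \<open>i < n\<close> gives
    \<open>f\<close> the shape of the componentwise continuity criterion.\<close>
  define f where "f = (\<lambda>y i. if i < n then (if i < ?k then \<psi>' (\<phi> (u y)) i else if i = ?k then nrm y else 0) else 0)"
  have "continuous_map (subtopology (Euclidean_space n) V) X (\<phi> \<circ> u)"
    using cont_p GV(4) continuous_map_from_subtopology_mono continuous_map_in_subtopology by blast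
  then have "continuous_map (subtopology (Euclidean_space n) V) (subtopology X (X closure_of G)) (\<phi> \<circ> u)"
    using GV(5) by (auto simp: continuous_map_in_subtopology topV K_def)
  then have "continuous_map (subtopology (Euclidean_space n) V) (Euclidean_space ?k) (\<psi>' \<circ> (\<phi> \<circ> u))"
    using G'(1) continuous_map_compose by blast
  then have "continuous_map (subtopology (Euclidean_space n) V) euclideanreal ((\<lambda>x. x i) \<circ> (\<psi>' \<circ> (\<phi> \<circ> u)))" for i
    using continuous_map_coordinate continuous_map_compose by blast
  moreover have "continuous_map (subtopology (Euclidean_space n) V) euclideanreal nrm"
    using cont_nrm continuous_map_from_subtopology by blast
  ultimately have "continuous_map (subtopology (Euclidean_space n) V) (Euclidean_space n) f"
    unfolding f_def continuous_map_componentwise_Euclidean_space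
    by (auto simp: o_def)
  moreover have "inj_on f V"
  proof (rule inj_onI)
    fix y z assume yz: "y \<in> V" "z \<in> V" "f y = f z"
    have k: "?k < n" "Suc ?k < n"
      using small[OF GV(1)] by auto
    have nrm: "nrm y = nrm z"
      using fun_cong[OF yz(3), of ?k] k by (simp add: f_def)
    have "\<psi>' (\<phi> (u y)) i = \<psi>' (\<phi> (u z)) i" if "i < ?k" for i
      using fun_cong[OF yz(3), of i] k that by (simp add: f_def)
    moreover have in_cl: "\<phi> (u y) \<in> X closure_of G" "\<phi> (u z) \<in> X closure_of G"
      using yz GV(5) by (auto simp: K_def)
    moreover have "\<psi>' (\<phi> (u y)) i = \<psi>' (\<phi> (u z)) i" if "i \<ge> ?k" for i
      using G'(2) in_cl that by (force simp: closed_unit_ball_def topspace_Euclidean_space)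
    ultimately have "\<psi>' (\<phi> (u y)) = \<psi>' (\<phi> (u z))"
      by (meson ext not_le)
    then have "\<phi> (u y) = \<phi> (u z)"
      using G'(2) in_cl by metis
    then have "u y = u z"
      using c(3) u_ball(1) yz GV(4) by (metis subsetD)
    have "y i = z i" for i
    proof (cases "i < n")
      case True
      then have "y i / nrm y = z i / nrm z"
        using fun_cong[OF \<open>u y = u z\<close>, of i] by (simp add: u_def)
      then show ?thesis
        using nrm yz(1) GV(4) by (auto simp: U_def)
    next
      case False
      moreover have "y \<in> topspace (Euclidean_space n)" "z \<in> topspace (Euclidean_space n)"
        using yz GV(4) unfolding U_def by blast+
      ultimately show ?thesis
        by (simp add: topspace_Euclidean_space)
    qed
    then show "y = z"
      by blast
  qed
  \<comment> \<open>As \<open>Suc (dm G) < n\<close>, the chart and the norm leave the last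
    coordinate zero, so the image lies in a hyperplane.\<close>
  moreover have "f y (n - 1) = 0" for y
    using small[OF GV(1)] by (auto simp: f_def)
  ultimately show False
    using no_injection_into_hyperplane[OF V GV(3), of f "n - 1"] n by simp
qed

section \<open>Chains in posets with boolean lower intervals\<close>

locale boolean_intervals =
  fixes P :: "'b set" and le :: "'b \<Rightarrow> 'b \<Rightarrow> bool" and bot :: 'b
  assumes finite_P: "finite P"
    and bot_P: "bot \<in> P"
    and bot_le: "F \<in> P \<Longrightarrow> le bot F"
    and le_refl: "F \<in> P \<Longrightarrow> le F F"
    and le_trans: "F \<in> P \<Longrightarrow> G \<in> P \<Longrightarrow> H \<in> P \<Longrightarrow> le F G \<Longrightarrow> le G H \<Longrightarrow> le F H"
    and boolean: "F \<in> P \<Longrightarrow> is_boolean_lattice {G \<in> P. le G F} le"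
begin

text \<open>A boolean lattice on \<open>k\<close> atoms has \<open>2 ^ k\<close> elements; counting
  the lower interval recovers \<open>k\<close> without choosing an isomorphism.\<close>

definition rank :: "'b \<Rightarrow> nat" where
  "rank F = (THE k. card {G \<in> P. le G F} = 2 ^ k)"

lemma rank_eq: "card {G \<in> P. le G F} = 2 ^ k \<Longrightarrow> rank F = k"
  unfolding rank_def by (intro the_equality) auto

text \<open>The isomorphism takes the interval below \<open>G\<close> onto the power set of
  \<open>\<psi> G\<close>, so the size of \<open>\<psi> G\<close> is the rank of
  \<open>G\<close>.\<close>

lemma interval_bij:
  assumes "F \<in> P"
  obtains S :: "nat set" and \<psi> where "finite S" "card S = rank F"
    "bij_betw \<psi> {G \<in> P. le G F} (Pow S)"
    "\<And>G H. G \<in> P \<Longrightarrow> le G F \<Longrightarrow> H \<in> P \<Longrightarrow> le H F \<Longrightarrow> le G H \<longleftrightarrow> \<psi> G \<subseteq> \<psi> H"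
    "\<And>G. G \<in> P \<Longrightarrow> le G F \<Longrightarrow> card (\<psi> G) = rank G"
proof -
  obtain S :: "nat set" and \<psi> where *: "finite S" "bij_betw \<psi> {G \<in> P. le G F} (Pow S)"
    "\<And>G H. G \<in> P \<Longrightarrow> le G F \<Longrightarrow> H \<in> P \<Longrightarrow> le H F \<Longrightarrow> le G H \<longleftrightarrow> \<psi> G \<subseteq> \<psi> H"
    using boolean[OF assms] unfolding is_boolean_lattice_def by blast
  have "card {G \<in> P. le G F} = 2 ^ card S"
    using bij_betw_same_card[OF *(2)] *(1) by (simp add: card_Pow)
  then have cardS: "card S = rank F"
    by (rule rank_eq[symmetric])
  have card\<psi>: "card (\<psi> G) = rank G" if G: "G \<in> P" "le G F" for G
  proof -
    have sub: "\<psi> G \<subseteq> S"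
      using bij_betwE[OF *(2)] G by auto
    have below: "le H F" if "H \<in> P" "le H G" for H
      using le_trans[OF that(1) G(1) assms that(2) G(2)] .
    then have "bij_betw \<psi> {H \<in> P. le H G} (\<psi> ` {H \<in> P. le H G})"
      by (intro bij_betw_subset[OF *(2)]) auto
    moreover have "\<psi> ` {H \<in> P. le H G} = Pow (\<psi> G)"
    proof (intro equalityI subsetI)
      fix A assume "A \<in> \<psi> ` {H \<in> P. le H G}"
      then obtain H where "H \<in> P" "le H G" "A = \<psi> H"
        by blast
      then show "A \<in> Pow (\<psi> G)"
        using *(3)[of H G] G below by simp
    next
      fix A assume A: "A \<in> Pow (\<psi> G)"
      then have "A \<in> \<psi> ` {G \<in> P. le G F}"
        using sub unfolding bij_betw_imp_surj_on[OF *(2)] by auto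
      then obtain H where "H \<in> P" "le H F" "A = \<psi> H"
        by blast
      then show "A \<in> \<psi> ` {H \<in> P. le H G}"
        using *(3)[of H G] G A by simp
    qed
    ultimately have "card {H \<in> P. le H G} = 2 ^ card (\<psi> G)"
      using sub *(1) by (metis bij_betw_same_card card_Pow finite_subset)
    then show ?thesis
      by (rule rank_eq[symmetric])
  qed
  show thesis
    by (rule that[OF *(1) cardS *(2,3) card\<psi>])
qed

lemma le_antisym:
  assumes "F \<in> P" "G \<in> P" "le F G" "le G F"
  shows "F = G"
proof -
  obtain S :: "nat set" and \<psi> where
    "bij_betw \<psi> {H \<in> P. le H F} (Pow S)"
    "\<And>G H. G \<in> P \<Longrightarrow> le G F \<Longrightarrow> H \<in> P \<Longrightarrow> le H F \<Longrightarrow> le G H \<longleftrightarrow> \<psi> G \<subseteq> \<psi> H"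
    using interval_bij[OF assms(1)] by metis
  then show ?thesis
    using assms le_refl unfolding bij_betw_def inj_on_def by (metis (mono_tags, lifting) mem_Collect_eq subset_antisym)
qed

lemma rank_less:
  assumes "F \<in> P" "G \<in> P" "le G F" "G \<noteq> F"
  shows "rank G < rank F"
proof -
  obtain S :: "nat set" and \<psi> where S: "finite S" "card S = rank F"
    "bij_betw \<psi> {H \<in> P. le H F} (Pow S)"
    "\<And>G H. G \<in> P \<Longrightarrow> le G F \<Longrightarrow> H \<in> P \<Longrightarrow> le H F \<Longrightarrow> le G H \<longleftrightarrow> \<psi> G \<subseteq> \<psi> H"
    "\<And>G. G \<in> P \<Longrightarrow> le G F \<Longrightarrow> card (\<psi> G) = rank G"
    by (rule interval_bij[OF assms(1)]) (rule that)
  note F = assms(1) le_refl[OF assms(1)]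
  have "\<psi> F \<subseteq> S"
    using bij_betwE[OF S(3)] F by auto
  moreover have "\<not> le F G"
    using le_antisym assms by blast
  then have "\<psi> G \<subset> \<psi> F"
    using S(4)[OF assms(2,3) F] S(4)[OF F assms(2,3)] assms(3) by blast
  ultimately have "card (\<psi> G) < card (\<psi> F)"
    using S(1) by (meson finite_subset psubset_card_mono)
  then show ?thesis
    using S(5)[OF assms(2,3)] S(5)[OF F] by simp
qed

text \<open>Elements of rank \<open>m\<close> below \<open>F\<close> correspond to the
  \<open>m\<close>-subsets of a set of size \<open>rank F\<close>. This is why chains below a face
  are counted by its rank alone.\<close>

lemma card_rank_below:
  assumes "F \<in> P"
  shows "card {G \<in> P. le G F \<and> rank G = m} = rank F choose m"
proof -
  obtain S :: "nat set" and \<psi> where S: "finite S" "card S = rank F"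
    "bij_betw \<psi> {H \<in> P. le H F} (Pow S)"
    "\<And>G. G \<in> P \<Longrightarrow> le G F \<Longrightarrow> card (\<psi> G) = rank G"
    by (rule interval_bij[OF assms(1)]) (rule that)
  have "bij_betw \<psi> {G \<in> P. le G F \<and> rank G = m} (\<psi> ` {G \<in> P. le G F \<and> rank G = m})"
    by (intro bij_betw_subset[OF S(3)]) auto
  moreover have "\<psi> ` {G \<in> P. le G F \<and> rank G = m} = {A. A \<subseteq> S \<and> card A = m}"
  proof (intro equalityI subsetI)
    fix A assume "A \<in> \<psi> ` {G \<in> P. le G F \<and> rank G = m}"
    then show "A \<in> {A. A \<subseteq> S \<and> card A = m}"
      using bij_betwE[OF S(3)] S(4) by auto
  next
    fix A assume A: "A \<in> {A. A \<subseteq> S \<and> card A = m}"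
    then have "A \<in> \<psi> ` {G \<in> P. le G F}"
      unfolding bij_betw_imp_surj_on[OF S(3)] by auto
    then obtain G where "G \<in> P" "le G F" "A = \<psi> G"
      by blast
    then show "A \<in> \<psi> ` {G \<in> P. le G F \<and> rank G = m}"
      using S(4)[of G] A by simp
  qed
  ultimately show ?thesis
    using n_subsets[OF S(1), of m] S(2) bij_betw_same_card by fastforce
qed

lemma rank_bot: "rank bot = 0"
proof (rule rank_eq)
  have "{G \<in> P. le G bot} = {bot}"
    using le_antisym[OF _ bot_P] bot_P bot_le le_refl by auto
  then show "card {G \<in> P. le G bot} = 2 ^ 0"
    by simp
qed

lemma rank_pos: "F \<in> P \<Longrightarrow> F \<noteq> bot \<Longrightarrow> rank F > 0"
  using rank_less[of F bot] bot_P bot_le by force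

lemma ex_coatom:
  assumes "F \<in> P" "F \<noteq> bot"
  obtains G where "G \<in> P" "le G F" "G \<noteq> F" "rank F = Suc (rank G)"
proof -
  have "card {G \<in> P. le G F \<and> rank G = rank F - 1} > 0"
    unfolding card_rank_below[OF assms(1)] by simp
  then obtain G where G: "G \<in> P" "le G F" "rank G = rank F - 1"
    by (auto simp: card_gt_0_iff)
  then show thesis
    using that[of G] rank_pos[OF assms] by force
qed

lemma sum_rank_below:
  fixes g :: "nat \<Rightarrow> real"
  assumes "F \<in> P"
  shows "(\<Sum>G | G \<in> P \<and> le G F \<and> G \<noteq> F. g (rank G)) = (\<Sum>m<rank F. of_nat (rank F choose m) * g m)"
proof -
  let ?A = "{G \<in> P. le G F \<and> G \<noteq> F}"
  have "rank ` ?A \<subseteq> {..<rank F}"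
    using rank_less[OF assms] by auto
  then have "(\<Sum>G\<in>?A. g (rank G)) = (\<Sum>m<rank F. \<Sum>G | G \<in> ?A \<and> rank G = m. g (rank G))"
    by (intro sum.group[symmetric]) (use finite_P in auto)
  also have "\<dots> = (\<Sum>m<rank F. of_nat (rank F choose m) * g m)"
  proof (rule sum.cong)
    fix m assume m: "m \<in> {..<rank F}"
    then have "{G \<in> ?A. rank G = m} = {G \<in> P. le G F \<and> rank G = m}"
      by auto
    then show "(\<Sum>G | G \<in> ?A \<and> rank G = m. g (rank G)) = of_nat (rank F choose m) * g m"
      using card_rank_below[OF assms, of m] by simp
  qed auto
  finally show ?thesis
    by simp
qed

section \<open>Chains sorted by their largest element\<close>

definition chains :: "'b set set" where
  "chains = {S. S \<subseteq> P - {bot} \<and> (\<forall>F\<in>S. \<forall>G\<in>S. le F G \<or> le G F)}"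

text \<open>\<open>insert bot S\<close> assigns the empty chain to \<open>bot\<close>, so that every
  chain belongs to exactly one \<open>F\<close> in \<open>P\<close>.\<close>

definition chains_to :: "'b \<Rightarrow> 'b set set" where
  "chains_to F = {S \<in> chains. F \<in> insert bot S \<and> (\<forall>G\<in>S. le G F)}"

lemma finite_chains: "finite chains"
  using finite_P by (intro finite_subset[of chains "Pow P"]) (auto simp: chains_def)

lemma finite_chains_to: "finite (chains_to F)"
  using finite_chains by (simp add: chains_to_def)

lemma finite_chain: "S \<in> chains \<Longrightarrow> finite S"
  using finite_P finite_subset unfolding chains_def by blast

lemma disjoint_chains_to:
  assumes "F \<in> P" "G \<in> P" "F \<noteq> G"
  shows "chains_to F \<inter> chains_to G = {}"
proof -
  have False if "S \<in> chains_to F" "S \<in> chains_to G" for S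
  proof -
    have "le G F" "le F G"
      using that assms bot_le unfolding chains_to_def by auto
    then show False
      using le_antisym assms by simp
  qed
  then show ?thesis
    by blast
qed

text \<open>In a nonempty chain an element of maximal rank lies above all others, since distinct
  comparable elements have different ranks.\<close>

lemma chains_eq: "chains = (\<Union>F\<in>P. chains_to F)"
proof (intro equalityI subsetI)
  fix S assume S: "S \<in> chains"
  show "S \<in> (\<Union>F\<in>P. chains_to F)"
  proof (cases "S = {}")
    case True
    then show ?thesis
      using S bot_P by (auto simp: chains_to_def)
  next
    case False
    obtain F where F: "F \<in> S" "rank F = Max (rank ` S)"
      using obtains_MAX[OF finite_chain[OF S] False] by metis
    have rank_le: "rank G \<le> rank F" if "G \<in> S" for G
      unfolding F(2) using that finite_chain[OF S] by simp
    have "le G F" if "G \<in> S" for G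
    proof -
      have "G \<in> P" "F \<in> P" "le F G \<or> le G F"
        using S that F unfolding chains_def by auto
      then show ?thesis
        using rank_less[of G F] rank_le[OF that] le_refl by force
    qed
    moreover have "F \<in> P"
      using S F unfolding chains_def by auto
    ultimately show ?thesis
      using S F by (auto simp: chains_to_def)
  qed
qed (auto simp: chains_to_def)

lemma chains_to_bot: "chains_to bot = {{}}"
proof -
  have "S = {}" if "S \<in> chains_to bot" for S
    using that le_antisym[OF _ bot_P] bot_le unfolding chains_to_def chains_def by auto
  moreover have "{} \<in> chains_to bot"
    by (auto simp: chains_to_def chains_def)
  ultimately show ?thesis
    by blast
qed

lemma chains_to_step:
  assumes F: "F \<in> P" "F \<noteq> bot"
  shows "chains_to F = insert F ` (\<Union>G\<in>{G\<in>P. le G F \<and> G \<noteq> F}. chains_to G)"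
    (is "_ = insert F ` ?U")
proof (intro equalityI subsetI)
  fix S assume S: "S \<in> chains_to F"
  then have "S - {F} \<in> chains"
    by (auto simp: chains_to_def chains_def)
  then obtain G where G: "G \<in> P" "S - {F} \<in> chains_to G"
    unfolding chains_eq by blast
  then have "G \<in> insert bot (S - {F})"
    by (auto simp: chains_to_def)
  then have "le G F" "G \<noteq> F"
    using S F bot_le by (auto simp: chains_to_def)
  then have "S - {F} \<in> ?U"
    using G by blast
  moreover have "S = insert F (S - {F})"
    using S F by (auto simp: chains_to_def)
  ultimately show "S \<in> insert F ` ?U"
    by blast
next
  fix S assume "S \<in> insert F ` ?U"
  then obtain G S' where G: "G \<in> P" "le G F" "G \<noteq> F" "S' \<in> chains_to G" "S = insert F S'"
    by blast
  have "H \<in> P \<and> le H F" if "H \<in> S'" for H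
    using that G F le_trans[of H G F] unfolding chains_to_def chains_def by auto
  then show "S \<in> chains_to F"
    using G(4,5) F le_refl unfolding chains_to_def chains_def by auto
qed

lemma top_notin_chains_to:
  assumes "F \<in> P" "F \<noteq> bot" "G \<in> P" "le G F" "G \<noteq> F" "S \<in> chains_to G"
  shows "F \<notin> S"
  using assms le_antisym[of F G] unfolding chains_to_def by auto

text \<open>Removing the largest face leaves a factor \<open>s\<close> and a chain ending at some
  \<open>G\<close> strictly below it; grouping these \<open>G\<close> by rank yields the assumed
  recursion for \<open>g\<close>.\<close>

lemma sum_chains_to:
  fixes s :: real
  assumes g0: "g 0 = 1" and g: "\<And>n. n > 0 \<Longrightarrow> g n = s * (\<Sum>m<n. of_nat (n choose m) * g m)"
    and "F \<in> P"
  shows "(\<Sum>S\<in>chains_to F. s ^ card S) = g (rank F)"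
  using \<open>F \<in> P\<close>
proof (induction "rank F" arbitrary: F rule: less_induct)
  case less
  show ?case
  proof (cases "F = bot")
    case True
    then show ?thesis
      by (simp add: chains_to_bot rank_bot g0)
  next
    case False
    let ?A = "{G\<in>P. le G F \<and> G \<noteq> F}"
    let ?U = "\<Union>G\<in>?A. chains_to G"
    note notin = top_notin_chains_to[OF less.prems False]
    have "inj_on (insert F) ?U"
    proof (rule inj_onI)
      fix S T assume "S \<in> ?U" "T \<in> ?U" "insert F S = insert F T"
      moreover from this have "F \<notin> S" "F \<notin> T"
        using notin by auto
      ultimately show "S = T"
        by (simp add: insert_ident)
    qed
    then have "(\<Sum>S\<in>chains_to F. s ^ card S) = (\<Sum>S\<in>?U. s ^ card (insert F S))"
      unfolding chains_to_step[OF less.prems False] by (subst sum.reindex) auto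
    also have "\<dots> = (\<Sum>S\<in>?U. s * s ^ card S)"
    proof (rule sum.cong)
      fix S assume "S \<in> ?U"
      then have "F \<notin> S" "finite S"
        using notin finite_chain by (auto simp: chains_to_def)
      then show "s ^ card (insert F S) = s * s ^ card S"
        by simp
    qed auto
    also have "\<dots> = s * (\<Sum>S\<in>?U. s ^ card S)"
      by (simp add: sum_distrib_left)
    also have "(\<Sum>S\<in>?U. s ^ card S) = (\<Sum>G\<in>?A. \<Sum>S\<in>chains_to G. s ^ card S)"
      using finite_P finite_chains_to disjoint_chains_to
      by (intro sum.UNION_disjoint) auto
    also have "\<dots> = (\<Sum>G\<in>?A. g (rank G))"
      using less rank_less by (intro sum.cong) auto
    also have "s * \<dots> = g (rank F)"
      using sum_rank_below[OF less.prems, of g] g[OF rank_pos[OF less.prems False]] by simp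
    finally show ?thesis .
  qed
qed

lemma sum_chains:
  fixes s :: real
  assumes "g 0 = 1" "\<And>n. n > 0 \<Longrightarrow> g n = s * (\<Sum>m<n. of_nat (n choose m) * g m)"
  shows "(\<Sum>S\<in>chains. s ^ card S) = (\<Sum>F\<in>P. g (rank F))"
proof -
  have "(\<Sum>S\<in>chains. s ^ card S) = (\<Sum>F\<in>P. \<Sum>S\<in>chains_to F. s ^ card S)"
    unfolding chains_eq using finite_P finite_chains_to disjoint_chains_to
    by (intro sum.UNION_disjoint) auto
  also have "\<dots> = (\<Sum>F\<in>P. g (rank F))"
    using assms by (intro sum.cong sum_chains_to) auto
  finally show ?thesis .
qed

lemma card_chains_to_le:
  assumes "F \<in> P" "S \<in> chains_to F"
  shows "card S \<le> rank F"
  using assms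
proof (induction "rank F" arbitrary: F S rule: less_induct)
  case less
  show ?case
  proof (cases "F = bot")
    case True
    then show ?thesis
      using less by (simp add: chains_to_bot)
  next
    case False
    then obtain G S' where G: "G \<in> P" "le G F" "G \<noteq> F" "S' \<in> chains_to G" "S = insert F S'"
      using less.prems chains_to_step[of F] by auto
    then have "card S' \<le> rank G" "rank G < rank F"
      using less rank_less[of F G] by auto
    moreover have "finite S'" 
      using G(4) finite_chain by (auto simp: chains_to_def)
    ultimately show ?thesis
      using card_insert_le_m1[of "rank F" S' F] G(5) by simp
  qed
qed

lemma ex_maximal_chain:
  assumes "F \<in> P"
  shows "\<exists>S\<in>chains_to F. card S = rank F"
  using assms
proof (induction "rank F" arbitrary: F rule: less_induct)
  case less
  show ?case
  proof (cases "F = bot")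
    case True
    then show ?thesis
      using less by (simp add: chains_to_bot rank_bot)
  next
    case False
    obtain G where G: "G \<in> P" "le G F" "G \<noteq> F" "rank F = Suc (rank G)"
      using ex_coatom[OF less.prems False] .
    then obtain S where S: "S \<in> chains_to G" "card S = rank G"
      using less by auto
    have "insert F S \<in> chains_to F"
      using chains_to_step[OF less.prems False] G S by blast
    moreover have "card (insert F S) = rank F"
      using top_notin_chains_to[OF less.prems False G(1-3) S(1)] S G(4) finite_chain
      by (auto simp: chains_to_def)
    ultimately show ?thesis
      by blast
  qed
qed

text \<open>Subdivision preserves dimension: ranks increase strictly along a chain, and descending
  through coatoms gives a chain of \<open>rank F\<close> elements ending at
  \<open>F\<close>.\<close>

lemma size_of_chains: "size_of card chains = size_of rank P"
  unfolding size_of_def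
proof (rule antisym)
  have "chains \<noteq> {}" "P \<noteq> {}"
    using chains_to_bot chains_eq bot_P by auto
  have "card S \<le> Max (rank ` P)" if S: "S \<in> chains" for S
  proof -
    obtain F where "F \<in> P" "S \<in> chains_to F"
      using S chains_eq by auto
    then show ?thesis
      using card_chains_to_le[of F S] finite_P by (auto intro: order_trans[OF _ Max_ge])
  qed
  then show "Max (card ` chains) \<le> Max (rank ` P)"
    using finite_chains \<open>chains \<noteq> {}\<close> by (subst Max_le_iff) auto
  have "rank F \<le> Max (card ` chains)" if F: "F \<in> P" for F
  proof -
    obtain S where "S \<in> chains" "card S = rank F"
      using ex_maximal_chain[OF F] chains_eq F by blast
    then show ?thesis
      using finite_chains by (metis Max_ge finite_imageI imageI)
  qed
  then show "Max (rank ` P) \<le> Max (card ` chains)"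
    using finite_P \<open>P \<noteq> {}\<close> by (subst Max_le_iff) auto
qed

end

section \<open>The face poset of a boolean cell complex\<close>

lemma boolean_cell_complex_intervals:
  assumes "boolean_cell_complex X C"
  shows "boolean_intervals (faces C) (face_le X) {}"
proof
  have C: "finite C" "\<Union>C = topspace X"
    using assms unfolding boolean_cell_complex_def regular_cell_complex_def by auto
  show "finite (faces C)" "{} \<in> faces C"
    using C by (auto simp: faces_def)
  show "face_le X {} F" for F
    by (simp add: face_le_def)
  show "face_le X F F" if "F \<in> faces C" for F
    using that C closure_of_subset[of F X] by (auto simp: faces_def face_le_def)
  show "face_le X F H" if "face_le X F G" "face_le X G H" for F G H
    using that by (metis closure_of_closure_of closure_of_mono face_le_def subset_trans)
  show "is_boolean_lattice {G \<in> faces C. face_le X G F} (face_le X)" if "F \<in> faces C" for F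
    using that assms by (auto simp: boolean_cell_complex_def)
qed

text \<open>Induction on the rank. A coatom has smaller dimension, so the rank is at most
  \<open>Suc (cell_dim X F)\<close>. Conversely, the boundary of a cell of positive dimension
  contains a cell of codimension at most one.\<close>

lemma face_rank_eq:
  assumes "boolean_cell_complex X C" "F \<in> faces C"
  shows "face_rank X F = boolean_intervals.rank (faces C) (face_le X) F"
proof -
  interpret boolean_intervals "faces C" "face_le X" "{}"
    using assms(1) by (rule boolean_cell_complex_intervals)
  have C: "finite C" "disjoint C" "\<And>e. e \<in> C \<Longrightarrow> \<exists>n. is_cell X n e"
    "\<And>e. e \<in> C \<Longrightarrow> \<exists>B\<subseteq>C. (X closure_of e) - e = \<Union>B"
    using assms(1) unfolding boolean_cell_complex_def regular_cell_complex_def by auto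
  have dim: "is_cell X (cell_dim X e) e" if "e \<in> C" for e
    using C(3)[OF that] cell_dim_eq by metis
  then have nonempty: "e \<noteq> {}" if "e \<in> C" for e
    using is_cell_nonempty that by blast
  have "Suc (cell_dim X F) = rank F" if "F \<in> C" for F
    using that
  proof (induction "rank F" arbitrary: F rule: less_induct)
    case less
    let ?n = "cell_dim X F"
    have F: "F \<in> faces C" "F \<noteq> {}"
      using less.prems nonempty by (auto simp: faces_def)
    have lower: "Suc (cell_dim X G) = rank G \<and> rank G < rank F"
      if "G \<in> C" "face_le X G F" "G \<noteq> F" for G
    proof -
      have "G \<in> faces C"
        using that by (simp add: faces_def)
      then have "rank G < rank F"
        using rank_less[OF F(1)] that by blast
      then show ?thesis
        using less.hyps that by blast
    qed
    have "rank F \<le> Suc ?n"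
    proof -
      obtain G where G: "G \<in> faces C" "face_le X G F" "G \<noteq> F" "rank F = Suc (rank G)"
        using ex_coatom[OF F] .
      show ?thesis
      proof (cases "G = {}")
        case True
        then show ?thesis
          using G(4) rank_bot by simp
      next
        case False
        then have "G \<in> C"
          using G(1) by (simp add: faces_def)
        moreover have "G \<inter> F = {}"
          using C(2) \<open>G \<in> C\<close> less.prems G(3) by (meson disjointD)
        ultimately have "cell_dim X G < ?n"
          using boundary_cell_dim_less[OF dim dim] less.prems G(2) by (auto simp: face_le_def)
        then show ?thesis
          using lower[OF \<open>G \<in> C\<close> G(2,3)] G(4) by simp
      qed
    qed
    moreover have "Suc ?n \<le> rank F"
    proof (cases "?n = 0")
      case True
      then show ?thesis
        using rank_pos[OF F] by simp
    next
      case False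
      obtain B where B: "B \<subseteq> C" "(X closure_of F) - F = \<Union>B"
        using C(4)[OF less.prems] by (elim exE conjE) (rule that)
      have B_cell: "is_cell X (cell_dim X G) G" if "G \<in> B" for G
        by (rule dim) (use B(1) that in blast)
      obtain G where G: "G \<in> B" "?n \<le> Suc (cell_dim X G)"
      proof (rule boundary_cell_dim_ge[OF dim[OF less.prems] _ finite_subset[OF B(1) C(1)] B(2) B_cell])
        show "0 < ?n"
          using False by simp
      qed (assumption, rule that)
      have sub: "G \<subseteq> (X closure_of F) - F"
        unfolding B(2) using G(1) by blast
      have "G \<in> C" "face_le X G F" "G \<noteq> F"
        using B(1) G(1) sub F(2) by (auto simp: face_le_def)
      then show ?thesis
        using lower[of G] G(2) by simp
    qed
    ultimately show ?case
      by simp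
  qed
  then show ?thesis
    using assms(2) rank_bot nonempty by (auto simp: faces_def face_rank_def)
qed

lemma barycentric_subdivision_eq:
  assumes "boolean_cell_complex X C"
  shows "barycentric_subdivision X C = boolean_intervals.chains (faces C) (face_le X) {}"
proof -
  interpret boolean_intervals "faces C" "face_le X" "{}"
    using assms by (rule boolean_cell_complex_intervals)
  have "finite C" "\<forall>e\<in>C. \<exists>n. is_cell X n e"
    using assms unfolding boolean_cell_complex_def regular_cell_complex_def by auto
  moreover from this have "{} \<notin> C"
    using is_cell_nonempty by blast
  ultimately show ?thesis
    unfolding chains_def barycentric_subdivision_def by (auto simp: faces_def intro: finite_subset)
qed

section \<open>Eulerian polynomials refined by the first letter\<close>

text \<open>
  \<open>eulerian t d j\<close> is the sum of \<open>t ^ des w\<close> over the permutations \<open>w\<close> of \<open>{1..d + 1}\<close> with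
  \<open>w 1 = j + 1\<close> (for \<open>j \<le> d\<close>); the recursion removes the first letter.
\<close>

primrec eulerian :: "real \<Rightarrow> nat \<Rightarrow> nat \<Rightarrow> real" where
  "eulerian t 0 j = 1"
| "eulerian t (Suc d) j = t * (\<Sum>k<j. eulerian t d k) + (\<Sum>k=j..d. eulerian t d k)"

text \<open>In the recursion the two sides differ only in the summand \<open>k = j\<close>, which
  has weight 1 for \<open>j\<close> and weight \<open>t\<close> for \<open>Suc j\<close>.\<close>

lemma eulerian_diff:
  assumes "j \<le> d"
  shows "eulerian t (Suc d) j - eulerian t (Suc d) (Suc j) = (1 - t) * eulerian t d j"
  using assms by (simp add: sum.atLeast_Suc_atMost algebra_simps)

lemma eulerian_last: "eulerian t (Suc d) (Suc d) = t * eulerian t (Suc d) 0"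
  by (simp add: atLeast0AtMost lessThan_Suc_atMost)

text \<open>The linear map sending the monomial of degree \<open>j\<close> to
  \<open>eulerian t d j\<close>. Applied to the \<open>h\<close>-polynomial of a boolean cell
  complex it will give that of the subdivision, evaluated at \<open>t\<close>.\<close>

definition eulerian_transform :: "real \<Rightarrow> nat \<Rightarrow> real poly \<Rightarrow> real" where
  "eulerian_transform t d p = (\<Sum>j\<le>d. coeff p j * eulerian t d j)"

lemma eulerian_transform_sum:
  "eulerian_transform t d (\<Sum>i\<in>I. smult (c i) (p i)) = (\<Sum>i\<in>I. c i * eulerian_transform t d (p i))"
  unfolding eulerian_transform_def
  by (simp add: coeff_sum sum_distrib_left sum_distrib_right sum.swap[of _ I] mult.assoc)

text \<open>Multiplication by \<open>[:1, -1:]\<close> replaces each Eulerian value by the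
  difference of two neighbours, which \<open>eulerian_diff\<close> evaluates. The degree bound
  removes the coefficient at \<open>Suc d\<close>.\<close>

lemma eulerian_transform_step:
  assumes "degree p \<le> d"
  shows "eulerian_transform t (Suc d) ([:1, -1:] * p) = (1 - t) * eulerian_transform t d p"
proof -
  have "[:1, -1:] * p = p - pCons 0 p"
    by (simp add: diff_conv_add_uminus del: add_uminus_conv_diff)
  have "eulerian_transform t (Suc d) ([:1, -1:] * p) =
      (\<Sum>j\<le>Suc d. coeff p j * eulerian t (Suc d) j) - (\<Sum>j\<le>Suc d. coeff (pCons 0 p) j * eulerian t (Suc d) j)"
    unfolding eulerian_transform_def \<open>[:1, -1:] * p = p - pCons 0 p\<close>
    by (simp add: left_diff_distrib sum_subtractf del: eulerian.simps sum.atMost_Suc)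
  also have "(\<Sum>j\<le>Suc d. coeff p j * eulerian t (Suc d) j) = (\<Sum>j\<le>d. coeff p j * eulerian t (Suc d) j)"
    using assms by (simp add: coeff_eq_0 del: eulerian.simps)
  also have "(\<Sum>j\<le>Suc d. coeff (pCons 0 p) j * eulerian t (Suc d) j) =
      (\<Sum>j\<le>d. coeff p j * eulerian t (Suc d) (Suc j))"
    by (simp add: sum.atMost_Suc_shift del: eulerian.simps sum.atMost_Suc)
  also have "(\<Sum>j\<le>d. coeff p j * eulerian t (Suc d) j) - \<dots> =
      (\<Sum>j\<le>d. coeff p j * (eulerian t (Suc d) j - eulerian t (Suc d) (Suc j)))"
    by (simp add: right_diff_distrib sum_subtractf del: eulerian.simps)
  also have "\<dots> = (\<Sum>j\<le>d. (1 - t) * (coeff p j * eulerian t d j))"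
  proof (rule sum.cong)
    fix j assume "j \<in> {..d}"
    then show "coeff p j * (eulerian t (Suc d) j - eulerian t (Suc d) (Suc j)) =
        (1 - t) * (coeff p j * eulerian t d j)"
      by (subst eulerian_diff) auto
  qed simp
  finally show ?thesis
    by (simp add: eulerian_transform_def sum_distrib_left)
qed

lemma degree_monom_one_minus_X_power:
  "degree (monom 1 r * [:1, -1:] ^ m :: real poly) \<le> r + m"
proof -
  have "degree ([:1, -1:] ^ m :: real poly) \<le> m"
    using degree_power_le[of "[:1, -1:] :: real poly" m] by simp
  then show ?thesis
    using degree_mult_le[of "monom 1 r :: real poly" "[:1, -1:] ^ m"] degree_monom_le[of "1::real" r]
    by linarith
qed

text \<open>The polynomial is the contribution of a face of rank \<open>r\<close> to the
  \<open>h\<close>-polynomial of a complex with \<open>size_of\<close> equal to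
  \<open>r + m\<close>; each factor \<open>[:1, -1:]\<close> comes out as
  \<open>1 - t\<close>.\<close>

lemma eulerian_transform_monom:
  "eulerian_transform t (r + m) (monom 1 r * [:1, -1:] ^ m) = (1 - t) ^ m * eulerian t r r"
proof (induction m)
  case 0
  have "(\<Sum>j\<le>r. (if r = j then 1 else 0) * eulerian t r j) = eulerian t r r"
    by (simp add: if_distrib[of "\<lambda>x. x * _"] cong: if_cong)
  then show ?case
    by (simp add: eulerian_transform_def)
next
  case (Suc m)
  have eq: "monom 1 r * [:1, -1:] ^ Suc m = [:1, -1:] * (monom 1 r * [:1, -1:] ^ m :: real poly)"
    by (simp only: power_Suc mult_ac)
  show ?case
    unfolding eq add_Suc_right eulerian_transform_step[OF degree_monom_one_minus_X_power] Suc.IH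
    by simp
qed

text \<open>Apply the transform to \<open>1 = (x + (1 - x)) ^ n\<close>, expanded binomially; the
  constant polynomial 1 is sent to \<open>eulerian t n 0\<close>.\<close>

lemma eulerian_first:
  "eulerian t n 0 = (\<Sum>m\<le>n. of_nat (n choose m) * ((1 - t) ^ (n - m) * eulerian t m m))"
proof -
  have "monom 1 1 + [:1, -1:] = (1 :: real poly)"
    by (simp add: monom_altdef)
  then have "(1 :: real poly) = (monom 1 1 + [:1, -1:]) ^ n"
    by simp
  also have "\<dots> = (\<Sum>m\<le>n. smult (of_nat (n choose m)) (monom 1 m * [:1, -1:] ^ (n - m)))"
    unfolding binomial_ring
    by (intro sum.cong) (simp_all add: monom_power of_nat_poly)
  finally have "eulerian_transform t n 1 =
      eulerian_transform t n (\<Sum>m\<le>n. smult (of_nat (n choose m)) (monom 1 m * [:1, -1:] ^ (n - m)))"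
    by (rule arg_cong)
  also have "\<dots> =
      (\<Sum>m\<le>n. of_nat (n choose m) * eulerian_transform t n (monom 1 m * [:1, -1:] ^ (n - m)))"
    by (rule eulerian_transform_sum)
  also have "\<dots> = (\<Sum>m\<le>n. of_nat (n choose m) * ((1 - t) ^ (n - m) * eulerian t m m))"
  proof (rule sum.cong)
    fix m assume "m \<in> {..n}"
    then show "of_nat (n choose m) * eulerian_transform t n (monom 1 m * [:1, -1:] ^ (n - m)) =
        of_nat (n choose m) * ((1 - t) ^ (n - m) * eulerian t m m)"
      using eulerian_transform_monom[of t m "n - m"] by simp
  qed simp
  also have "eulerian_transform t n 1 = eulerian t n 0"
    by (simp add: eulerian_transform_def if_distrib[of "\<lambda>x. x * _"] cong: if_cong)
  finally show ?thesis .
qed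

text \<open>Combining \<open>eulerian_first\<close> with \<open>eulerian_last\<close> and moving the
  summand \<open>m = n\<close> to the left yields the recursion demanded by
  \<open>sum_chains\<close> for \<open>s = t / (1 - t)\<close>.\<close>

lemma eulerian_diag:
  assumes "n > 0" "t \<noteq> 1"
  shows "eulerian t n n / (1 - t) ^ n =
    t / (1 - t) * (\<Sum>m<n. of_nat (n choose m) * (eulerian t m m / (1 - t) ^ m))"
proof -
  have "eulerian t n n = t * eulerian t n 0"
    using eulerian_last[of t "n - 1"] assms(1) by (simp del: eulerian.simps)
  also have "\<dots> = t * eulerian t n n + t * (\<Sum>m<n. of_nat (n choose m) * ((1 - t) ^ (n - m) * eulerian t m m))"
    unfolding eulerian_first[of t n]
    by (simp add: lessThan_Suc_atMost[symmetric] algebra_simps del: eulerian.simps)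
  also have "(\<Sum>m<n. of_nat (n choose m) * ((1 - t) ^ (n - m) * eulerian t m m)) =
      (1 - t) ^ n * (\<Sum>m<n. of_nat (n choose m) * (eulerian t m m / (1 - t) ^ m))"
    unfolding sum_distrib_left
    using assms(2) by (intro sum.cong) (auto simp: power_diff)
  finally show ?thesis
    using assms(2) by (simp add: field_simps)
qed

lemma sum_h_vec_eulerian:
  assumes "finite D"
  shows "(\<Sum>j\<le>size_of \<rho> D. h_vec \<rho> D j * eulerian t (size_of \<rho> D) j) =
    (\<Sum>F\<in>D. (1 - t) ^ (size_of \<rho> D - \<rho> F) * eulerian t (\<rho> F) (\<rho> F))"
proof -
  let ?d = "size_of \<rho> D"
  have "(\<Sum>j\<le>?d. h_vec \<rho> D j * eulerian t ?d j) =
      eulerian_transform t ?d (\<Sum>F\<in>D. smult 1 (monom 1 (\<rho> F) * [:1, -1:] ^ (?d - \<rho> F)))"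
    unfolding eulerian_transform_def h_vec_def h_poly_eq[OF assms] by simp
  also have "\<dots> = (\<Sum>F\<in>D. eulerian_transform t ?d (monom 1 (\<rho> F) * [:1, -1:] ^ (?d - \<rho> F)))"
    unfolding eulerian_transform_sum by simp
  also have "\<dots> = (\<Sum>F\<in>D. (1 - t) ^ (?d - \<rho> F) * eulerian t (\<rho> F) (\<rho> F))"
  proof (rule sum.cong)
    fix F assume "F \<in> D"
    then have "\<rho> F \<le> ?d"
      unfolding size_of_def using assms by simp
    then show "eulerian_transform t ?d (monom 1 (\<rho> F) * [:1, -1:] ^ (?d - \<rho> F)) =
        (1 - t) ^ (?d - \<rho> F) * eulerian t (\<rho> F) (\<rho> F)"
      using eulerian_transform_monom[of t "\<rho> F" "?d - \<rho> F"] by simp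
  qed simp
  finally show ?thesis .
qed

section \<open>Balanced complexes built from cones\<close>

definition face_sum :: "real \<Rightarrow> nat set set \<Rightarrow> real" where
  "face_sum x K = (\<Sum>S\<in>K. x ^ card S)"

abbreviation face_sums :: "real \<Rightarrow> nat set set list \<Rightarrow> real" where
  "face_sums x Gs \<equiv> (\<Sum>G\<leftarrow>Gs. face_sum x G)"

text \<open>The apex encodes the step \<open>d\<close> and the list position, so repeated entries of
  \<open>Gs\<close> receive separate apexes. The bases of the cones are meant to lie in
  \<open>K\<close> already.\<close>

definition attach_cones :: "nat \<Rightarrow> nat set set \<Rightarrow> nat set set list \<Rightarrow> nat set set" where
  "attach_cones d K Gs = K \<union> (\<Union>i<length Gs. insert (prod_encode (d, i)) ` (Gs ! i))"

text \<open>
  Vertices added in step \<open>d\<close> have level \<open>d\<close>, and their links only contain vertices of level at most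
  \<open>d - 2\<close>; hence the vertices of a face have distinct colours.
\<close>

definition level :: "nat \<Rightarrow> nat" where
  "level v = fst (prod_decode v)"

text \<open>Levels \<open>2 * c + 2\<close> and \<open>2 * c + 3\<close> share colour
  \<open>c\<close>. Levels that differ by two or more are thus separated, and the levels from 2 to
  \<open>d\<close> need \<open>d div 2\<close> colours.\<close>

definition colour :: "nat \<Rightarrow> nat" where
  "colour v = level v div 2 - 1"

definition levelled :: "nat \<Rightarrow> nat set set \<Rightarrow> bool" where
  "levelled d K \<longleftrightarrow> abstract_simplicial_complex K \<and>
     (\<forall>S\<in>K. inj_on colour S \<and> (\<forall>v\<in>S. 2 \<le> level v \<and> level v < d))"

lemma level_prod_encode [simp]: "level (prod_encode (d, i)) = d"
  by (simp add: level_def)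

lemma levelled_mono: "levelled d K \<Longrightarrow> d \<le> e \<Longrightarrow> levelled e K"
  unfolding levelled_def by fastforce

lemma levelled_empty:
  assumes "levelled d K"
  shows "{} \<in> K"
proof -
  have "K \<noteq> {}" "\<And>S T. S \<in> K \<Longrightarrow> T \<subseteq> S \<Longrightarrow> T \<in> K"
    using assms unfolding levelled_def abstract_simplicial_complex_def by auto
  then show ?thesis
    by (metis empty_subsetI ex_in_conv)
qed

lemma levelled_singleton: "levelled d {{}}"
  unfolding levelled_def abstract_simplicial_complex_def by auto

lemma attach_cones_superset: "K \<subseteq> attach_cones d K Gs"
  by (simp add: attach_cones_def)

text \<open>Apexes are numbered by list position, so appending links keeps the earlier
  cones.\<close>

lemma attach_cones_append: "attach_cones d K Gs \<subseteq> attach_cones d K (Gs @ Hs)"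
proof -
  have "(\<Union>i<length Gs. insert (prod_encode (d, i)) ` (Gs ! i)) \<subseteq>
      (\<Union>i<length (Gs @ Hs). insert (prod_encode (d, i)) ` ((Gs @ Hs) ! i))"
  proof (rule UN_mono)
    fix i assume "i \<in> {..<length Gs}"
    then show "insert (prod_encode (d, i)) ` (Gs ! i) \<subseteq> insert (prod_encode (d, i)) ` ((Gs @ Hs) ! i)"
      by (simp add: nth_append)
  qed auto
  then show ?thesis
    unfolding attach_cones_def by blast
qed

lemma levelled_attach_cones:
  assumes K: "levelled d K" and d: "Gs \<noteq> [] \<Longrightarrow> d \<ge> 2"
    and G: "\<And>G. G \<in> set Gs \<Longrightarrow> levelled (d - 1) G \<and> G \<subseteq> K"
  shows "levelled (Suc d) (attach_cones d K Gs)"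
  unfolding levelled_def abstract_simplicial_complex_def
proof (intro conjI ballI allI impI)
  have K': "finite K" "K \<noteq> {}" "\<And>S. S \<in> K \<Longrightarrow> finite S" "\<And>S T. S \<in> K \<Longrightarrow> T \<subseteq> S \<Longrightarrow> T \<in> K"
    "\<And>S. S \<in> K \<Longrightarrow> inj_on colour S" "\<And>S v. S \<in> K \<Longrightarrow> v \<in> S \<Longrightarrow> 2 \<le> level v \<and> level v < d"
    using K unfolding levelled_def abstract_simplicial_complex_def by auto
  have nthG: "levelled (d - 1) (Gs ! i) \<and> Gs ! i \<subseteq> K" if "i < length Gs" for i
    using G[OF nth_mem[OF that]] .
  show "finite (attach_cones d K Gs)"
    using K'(1) nthG unfolding attach_cones_def levelled_def abstract_simplicial_complex_def by auto
  show "attach_cones d K Gs \<noteq> {}"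
    using K'(2) by (simp add: attach_cones_def)
  fix S assume S: "S \<in> attach_cones d K Gs"
  then consider "S \<in> K" | i S' where "i < length Gs" "S' \<in> Gs ! i" "S = insert (prod_encode (d, i)) S'"
    unfolding attach_cones_def by auto
  note cases = this
  show "finite S"
  proof (cases rule: cases)
    case 1
    then show ?thesis using K'(3) by simp
  next
    case (2 i S')
    then show ?thesis using K'(3)[of S'] nthG by auto
  qed
  show "T \<in> attach_cones d K Gs" if "T \<subseteq> S" for T
  proof (cases rule: cases)
    case 1
    then show ?thesis
      using K'(4)[of S T] that attach_cones_superset[of K d Gs] by auto
  next
    case (2 i S')
    let ?v = "prod_encode (d, i)"
    have "T - {?v} \<subseteq> S'"
      using that 2(3) by auto
    then have T: "T - {?v} \<in> Gs ! i"
      using nthG[OF 2(1)] 2(2) unfolding levelled_def abstract_simplicial_complex_def by auto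
    show ?thesis
    proof (cases "?v \<in> T")
      case True
      then have "T = insert ?v (T - {?v})"
        by auto
      then have "T \<in> insert ?v ` (Gs ! i)"
        using T by (rule image_eqI)
      then show ?thesis
        using 2(1) unfolding attach_cones_def by auto
    next
      case False
      then have "T \<in> K"
        using T nthG[OF 2(1)] by auto
      then show ?thesis
        using attach_cones_superset[of K d Gs] by auto
    qed
  qed
  show "inj_on colour S"
  proof (cases rule: cases)
    case 1
    then show ?thesis using K'(5) by simp
  next
    case (2 i S')
    have S': "inj_on colour S'" "\<And>v. v \<in> S' \<Longrightarrow> 2 \<le> level v \<and> level v < d - 1"
      using nthG[OF 2(1)] 2(2) unfolding levelled_def by auto
    \<comment> \<open>Vertices of the link have level at most \<open>d - 2\<close>, so halving
      separates their colours from that of the apex.\<close>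
    have "colour v < colour (prod_encode (d, i))" if "v \<in> S'" for v
    proof -
      have "level v + 2 \<le> d" "2 \<le> level v"
        using S'(2)[OF that] by auto
      then have "level v div 2 + 1 \<le> d div 2" "1 \<le> level v div 2"
        by linarith+
      then show ?thesis
        by (simp add: colour_def)
    qed
    then show ?thesis
      unfolding 2(3) using S'(1) by (fastforce simp: inj_on_insert)
  qed
  show "2 \<le> level v" "level v < Suc d" if "v \<in> S" for v
  proof -
    have "2 \<le> level v \<and> level v < Suc d"
    proof (cases rule: cases)
      case 1
      then show ?thesis using K'(6)[OF 1 that] by simp
    next
      case (2 i S')
      have "d \<ge> 2"
        by (rule d) (use 2(1) in auto)
      then show ?thesis
        using K'(6)[of S' v] nthG[OF 2(1)] 2(2,3) that by auto
    qed
    then show "2 \<le> level v" "level v < Suc d"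
      by auto
  qed
qed

text \<open>No face of \<open>K\<close> has a vertex of level \<open>d\<close>, so the cones
  contribute pairwise distinct new faces, each with one vertex more than the face of the link that
  it extends.\<close>

lemma face_sum_attach_cones:
  assumes K: "levelled d K" and G: "\<And>G. G \<in> set Gs \<Longrightarrow> G \<subseteq> K"
  shows "face_sum x (attach_cones d K Gs) = face_sum x K + x * face_sums x Gs"
proof -
  have K': "finite K" "\<And>S. S \<in> K \<Longrightarrow> finite S" "\<And>S v. S \<in> K \<Longrightarrow> v \<in> S \<Longrightarrow> level v < d"
    using K unfolding levelled_def abstract_simplicial_complex_def by auto
  let ?v = "\<lambda>i. prod_encode (d, i)"
  let ?A = "\<lambda>i. insert (?v i) ` (Gs ! i)"
  have nthG: "Gs ! i \<subseteq> K" if "i < length Gs" for i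
    using G[OF nth_mem[OF that]] .
  have fin: "finite (?A i)" if "i < length Gs" for i
    using nthG[OF that] K'(1) finite_subset by blast
  have notin: "?v i \<notin> S" if "S \<in> K" for S i
    using K'(3)[OF that, of "?v i"] by auto
  have disj: "?A i \<inter> ?A j = {}" if "i < length Gs" "j < length Gs" "i \<noteq> j" for i j
  proof -
    have False if "S \<in> K" "T \<in> K" "insert (?v i) S = insert (?v j) T" for S T
    proof -
      have "?v i \<in> insert (?v j) T"
        using that(3) by blast
      then show False
        using notin[OF that(2)] \<open>i \<noteq> j\<close> by simp
    qed
    then show ?thesis
      using nthG[OF that(1)] nthG[OF that(2)] by blast
  qed
  have sumA: "(\<Sum>S\<in>?A i. x ^ card S) = x * face_sum x (Gs ! i)" if "i < length Gs" for i
  proof -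
    have sub: "S \<in> K" if "S \<in> Gs ! i" for S
      using nthG[OF \<open>i < length Gs\<close>] that by blast
    have "inj_on (insert (?v i)) (Gs ! i)"
      using sub notin by (intro inj_onI) (simp add: insert_ident)
    then have "(\<Sum>S\<in>?A i. x ^ card S) = (\<Sum>S\<in>Gs ! i. x ^ card (insert (?v i) S))"
      by (subst sum.reindex) auto
    also have "\<dots> = (\<Sum>S\<in>Gs ! i. x * x ^ card S)"
      using sub notin K'(2) by (intro sum.cong) auto
    finally show ?thesis
      by (simp add: face_sum_def sum_distrib_left)
  qed
  have "K \<inter> (\<Union>i<length Gs. ?A i) = {}"
    using notin by auto
  then have "face_sum x (attach_cones d K Gs) = face_sum x K + (\<Sum>S\<in>(\<Union>i<length Gs. ?A i). x ^ card S)"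
    unfolding face_sum_def attach_cones_def using K'(1) fin by (intro sum.union_disjoint) auto
  also have "(\<Sum>S\<in>(\<Union>i<length Gs. ?A i). x ^ card S) = (\<Sum>i<length Gs. \<Sum>S\<in>?A i. x ^ card S)"
    using fin disj by (intro sum.UNION_disjoint) auto
  also have "\<dots> = x * (\<Sum>i<length Gs. face_sum x (Gs ! i))"
    unfolding sum_distrib_left using sumA by (intro sum.cong) auto
  also have "(\<Sum>i<length Gs. face_sum x (Gs ! i)) = face_sums x Gs"
    by (simp add: sum_list_sum_nth atLeast0LessThan)
  finally show ?thesis .
qed

text \<open>
  With \<open>x = t / (1 + t)\<^sup>2\<close>, the \<open>f\<close>-polynomial of \<open>skel d\<close> is the \<open>\<gamma>\<close>-polynomial belonging to
  \<open>E d 0 + E d d\<close>. For \<open>j \<ge> 1\<close> the one belonging to \<open>E d j + E d (d - j)\<close> (to \<open>E d j\<close> alone if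
  \<open>2 * j = d\<close>) is \<open>x\<close> times the sum of the \<open>f\<close>-polynomials in \<open>alinks d j\<close>, and likewise for
  \<open>t * E d j + E d (d - j)\<close> and \<open>blinks d j\<close> if \<open>d \<ge> 1\<close>. Only indices with \<open>2 * j \<le> d\<close> are meaningful.
  Listing the links in decreasing order of the index makes the complexes attached in \<open>blinks\<close>
  subcomplexes of \<open>skel (Suc d)\<close>.
\<close>

fun skel :: "nat \<Rightarrow> nat set set"
  and alinks :: "nat \<Rightarrow> nat \<Rightarrow> nat set set list"
  and blinks :: "nat \<Rightarrow> nat \<Rightarrow> nat set set list" where
  "skel 0 = {{}}"
| "skel (Suc d) = attach_cones d (skel d) (concat (map (alinks d) (rev [1..<Suc (d div 2)])))"
| "alinks 0 j = []"
| "alinks (Suc d) j =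
     concat (map (blinks d) [0..<j]) @
     (if 2 * j = Suc d then []
      else concat (map (blinks d) [0..<j]) @ concat (map (alinks d) (rev [j..<Suc (d div 2)])))"
| "blinks 0 j = []"
| "blinks (Suc d) j =
     (if j = 0 then replicate 2 (skel (Suc d))
      else replicate 2 (attach_cones d (skel d) (concat (map (alinks d) (rev [j..<Suc (d div 2)])))) @
        concat (map (blinks d) [1..<j]))"

section \<open>The complexes \<open>skel d\<close> and their links\<close>

abbreviation alinks_from :: "nat \<Rightarrow> nat \<Rightarrow> nat set set list" where
  "alinks_from d j \<equiv> concat (map (alinks d) (rev [j..<Suc (d div 2)]))"

text \<open>The decreasing order makes the links of index at least \<open>j\<close> a prefix of the
  full list, so their cones have the same apexes in both complexes.\<close>

lemma alinks_from_prefix: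
  assumes "1 \<le> j" "j \<le> Suc (d div 2)"
  shows "alinks_from d 1 = alinks_from d j @ concat (map (alinks d) (rev [1..<j]))"
proof -
  have "[1..<Suc (d div 2)] = [1..<j] @ [j..<Suc (d div 2)]"
    using upt_add_eq_append[of 1 j "Suc (d div 2) - j"] assms by simp
  then show ?thesis
    by (simp del: upt_Suc)
qed

text \<open>The three claims depend on each other. Links in \<open>alinks d j\<close> stay one level
  lower, as required for coning in step \<open>d\<close>; those in \<open>blinks d j\<close> serve
  as links in step \<open>Suc d\<close>.\<close>

lemma skel_links:
  "levelled d (skel d) \<and>
   (\<forall>j. 1 \<le> j \<and> 2 * j \<le> d \<longrightarrow> (\<forall>G\<in>set (alinks d j). levelled (d - 1) G \<and> G \<subseteq> skel (d - 1))) \<and>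
   (\<forall>j. 2 * j \<le> d \<longrightarrow> (\<forall>G\<in>set (blinks d j). levelled d G \<and> G \<subseteq> skel d))"
proof (induction d)
  case 0
  show ?case
    by (simp add: levelled_singleton)
next
  case (Suc d)
  have skel: "levelled d (skel d)"
    using Suc.IH by (rule conjunct1)
  have alinks: "levelled (d - 1) G \<and> G \<subseteq> skel (d - 1)"
    if "1 \<le> j" "2 * j \<le> d" "G \<in> set (alinks d j)" for j G
    using Suc.IH[THEN conjunct2, THEN conjunct1] that by simp
  have blinks: "levelled d G \<and> G \<subseteq> skel d" if "2 * j \<le> d" "G \<in> set (blinks d j)" for j G
    using Suc.IH[THEN conjunct2, THEN conjunct2] that by simp
  have "skel (d - 1) \<subseteq> skel d"
    using attach_cones_superset by (cases d) auto
  have from1: "levelled (d - 1) G \<and> G \<subseteq> skel d" if G: "G \<in> set (alinks_from d j)" "1 \<le> j" for G j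
  proof -
    obtain k where "j \<le> k" "k \<le> d div 2" "G \<in> set (alinks d k)"
      using G(1) by (auto simp del: upt_Suc)
    then have "1 \<le> k" "2 * k \<le> d"
      using G(2) by linarith+
    then show ?thesis
      using alinks[of k G] \<open>G \<in> set (alinks d k)\<close> \<open>skel (d - 1) \<subseteq> skel d\<close> by auto
  qed
  have nonempty: "d \<ge> 2" if "alinks_from d j \<noteq> []" "1 \<le> j" for j
  proof (rule ccontr)
    assume "\<not> d \<ge> 2"
    then have "[j..<Suc (d div 2)] = []"
      using that(2) by simp
    then show False
      using that(1) by simp
  qed
  have attach: "levelled (Suc d) (attach_cones d (skel d) (alinks_from d j))" if "1 \<le> j" for j
    using levelled_attach_cones[OF skel nonempty[OF _ that] from1[OF _ that]] .
  have skel': "levelled (Suc d) (skel (Suc d))" "skel d \<subseteq> skel (Suc d)"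
    using attach[of 1] attach_cones_superset by auto
  have attach_sub: "attach_cones d (skel d) (alinks_from d j) \<subseteq> skel (Suc d)"
    if "1 \<le> j" "j \<le> Suc (d div 2)" for j
    unfolding skel.simps alinks_from_prefix[OF that] by (rule attach_cones_append)
  have A: "levelled d G \<and> G \<subseteq> skel d"
    if j: "1 \<le> j" "2 * j \<le> Suc d" and G: "G \<in> set (alinks (Suc d) j)" for j G
  proof -
    consider k where "k < j" "G \<in> set (blinks d k)" | "G \<in> set (alinks_from d j)"
      using G by (auto simp del: upt_Suc split: if_splits)
    then show ?thesis
    proof cases
      case 1
      then show ?thesis
        using blinks[of k G] j by simp
    next
      case 2
      then show ?thesis
        using from1[OF 2 j(1)] levelled_mono[of "d - 1" G d] by simp
    qed
  qed
  have B: "levelled (Suc d) G \<and> G \<subseteq> skel (Suc d)"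
    if j: "2 * j \<le> Suc d" and G: "G \<in> set (blinks (Suc d) j)" for j G
  proof (cases "j = 0")
    case True
    then show ?thesis
      using G skel' by simp
  next
    case False
    then consider k where "1 \<le> k" "k < j" "G \<in> set (blinks d k)"
      | "G = attach_cones d (skel d) (alinks_from d j)"
      using G by (auto simp del: upt_Suc skel.simps)
    then show ?thesis
    proof cases
      case 1
      then show ?thesis
        using blinks[of k G] j levelled_mono[of d G "Suc d"] skel'(2) by auto
    next
      case 2
      have "j \<le> Suc (d div 2)"
        using j by linarith
      then show ?thesis
        using attach[of j] attach_sub[of j] False unfolding 2 by simp
    qed
  qed
  have "\<forall>j. 1 \<le> j \<and> 2 * j \<le> Suc d \<longrightarrow>
      (\<forall>G\<in>set (alinks (Suc d) j). levelled d G \<and> G \<subseteq> skel d)"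
    using A by (intro allI impI ballI, elim conjE)
  moreover have "\<forall>j. 2 * j \<le> Suc d \<longrightarrow>
      (\<forall>G\<in>set (blinks (Suc d) j). levelled (Suc d) G \<and> G \<subseteq> skel (Suc d))"
    using B by (intro allI impI ballI)
  ultimately show ?case
    unfolding diff_Suc_1 using skel'(1) by (intro conjI)
qed

lemma levelled_skel: "levelled d (skel d)"
  using skel_links by (rule conjunct1)

lemma alinks_subset:
  assumes "1 \<le> j" "2 * j \<le> d" "G \<in> set (alinks d j)"
  shows "levelled (d - 1) G" "G \<subseteq> skel d"
proof -
  have G: "levelled (d - 1) G \<and> G \<subseteq> skel (d - 1)"
    using skel_links[of d, THEN conjunct2, THEN conjunct1] assms by simp
  then show "levelled (d - 1) G"
    by simp
  have "G \<subseteq> skel (d - 1)"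
    using G by simp
  also have "\<dots> \<subseteq> skel d"
    using attach_cones_superset by (cases d) auto
  finally show "G \<subseteq> skel d" .
qed

text \<open>The list \<open>blinks (d - 1) 0\<close> consists of copies of
  \<open>skel (d - 1)\<close>. This link supplies faces of the size needed for balancedness.\<close>

lemma skel_in_alinks:
  assumes "1 \<le> j" "2 * j \<le> d"
  shows "skel (d - 1) \<in> set (alinks d j)"
proof -
  obtain e where d: "d = Suc (Suc e)"
    using assms by (cases d; cases "d - 1") auto
  have "skel (Suc e) \<in> set (blinks (Suc e) 0)"
    by simp
  moreover have "0 \<in> set [0..<j]"
    using assms by simp
  ultimately have "skel (Suc e) \<in> set (concat (map (blinks (Suc e)) [0..<j]))"
    unfolding set_concat set_map by blast
  then show ?thesis
    unfolding d alinks.simps by (simp del: blinks.simps skel.simps)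
qed

lemma attach_cones_card:
  assumes K: "levelled d K" and G: "G \<in> set Gs" "G \<subseteq> K" and S: "S \<in> G"
  shows "\<exists>T\<in>attach_cones d K Gs. card T = Suc (card S)"
proof -
  obtain i where i: "i < length Gs" "G = Gs ! i"
    using G(1) by (auto simp: in_set_conv_nth)
  have "insert (prod_encode (d, i)) S \<in> attach_cones d K Gs"
    using i S unfolding attach_cones_def by auto
  moreover have "S \<in> K"
    using G(2) S by auto
  then have "finite S" "\<And>v. v \<in> S \<Longrightarrow> level v < d"
    using K unfolding levelled_def abstract_simplicial_complex_def by auto
  moreover from this(2)[of "prod_encode (d, i)"] have "prod_encode (d, i) \<notin> S"
    by auto
  ultimately show ?thesis
    by (intro bexI[of _ "insert (prod_encode (d, i)) S"]) auto
qed

text \<open>Some face must have as many vertices as there are colours. For odd \<open>d\<close> a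
  cone over a large face of \<open>skel (d - 2)\<close> gains a vertex; for even \<open>d\<close>
  the size is that already reached in \<open>skel (d - 1)\<close>.\<close>

lemma skel_large_face: "\<exists>S\<in>skel d. card S = (d - 1) div 2"
proof (induction d rule: less_induct)
  case (less d)
  show ?case
  proof (cases "2 \<le> d")
    case False
    have "{} \<in> skel d"
      using levelled_skel by (rule levelled_empty)
    then show ?thesis
      using False by (intro bexI[of _ "{}"]) auto
  next
    case True
    then obtain e where d: "d = Suc e" "1 \<le> e"
      by (cases d) auto
    show ?thesis
    proof (cases "even e")
      case True
      have "\<exists>S\<in>skel (e - 1). card S = (e - 1 - 1) div 2"
        by (rule less) (use d in simp)
      then obtain S where S: "S \<in> skel (e - 1)" "card S = (e - 1 - 1) div 2"
        by blast
      have e: "2 \<le> e"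
        using d True by (cases "e = 1") auto
      then have 1: "skel (e - 1) \<in> set (alinks e 1)"
        by (intro skel_in_alinks) auto
      have "1 \<in> set (rev [1..<Suc (e div 2)])"
        using e by (auto simp del: upt_Suc)
      with 1 have "skel (e - 1) \<in> set (alinks_from e 1)"
        unfolding set_concat set_map by blast
      moreover have "skel (e - 1) \<subseteq> skel e"
        using alinks_subset(2)[OF _ _ 1] e by simp
      ultimately obtain T where "T \<in> skel d" "card T = Suc (card S)"
        using attach_cones_card[OF levelled_skel _ _ S(1)] unfolding d skel.simps by blast
      moreover have "Suc (card S) = (d - 1) div 2"
        using S(2) d True e by (auto elim!: evenE)
      ultimately show ?thesis
        by auto
    next
      case False
      have "\<exists>S\<in>skel e. card S = (e - 1) div 2"
        by (rule less) (use d in simp)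
      then obtain S where S: "S \<in> skel e" "card S = (e - 1) div 2"
        by blast
      moreover have "skel e \<subseteq> skel d"
        unfolding d skel.simps by (rule attach_cones_superset)
      moreover have "(e - 1) div 2 = (d - 1) div 2"
        using False d by (auto elim!: oddE)
      ultimately show ?thesis
        by auto
    qed
  qed
qed

section \<open>Recursions for the palindromic sums\<close>

definition folded :: "(nat \<Rightarrow> real) \<Rightarrow> nat \<Rightarrow> nat \<Rightarrow> real" where
  "folded f d j = (if 2 * j = d then f j else f j + f (d - j))"

lemma sum_symmetric_weights:
  fixes w f :: "nat \<Rightarrow> real"
  assumes "\<And>k. k \<le> d \<Longrightarrow> w (d - k) = w k"
  shows "(\<Sum>k\<le>d. w k * f k) = (\<Sum>k\<le>d div 2. w k * folded f d k)"
proof -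
  have "{..d} = {..d div 2} \<union> {d div 2<..d}"
    by auto
  then have "(\<Sum>k\<le>d. w k * f k) = (\<Sum>k\<le>d div 2. w k * f k) + (\<Sum>k\<in>{d div 2<..d}. w k * f k)"
    by (subst sum.union_disjoint[symmetric]) auto
  also have "(\<Sum>k\<in>{d div 2<..d}. w k * f k) = (\<Sum>k\<in>{k. 2 * k < d}. w (d - k) * f (d - k))"
    by (rule sum.reindex_bij_witness[of _ "\<lambda>k. d - k" "\<lambda>k. d - k"]) auto
  also have "\<dots> = (\<Sum>k\<le>d div 2. if 2 * k < d then w k * f (d - k) else 0)"
    by (subst sum.If_cases) (auto intro!: sum.cong simp: assms)
  also have "(\<Sum>k\<le>d div 2. w k * f k) + \<dots> = (\<Sum>k\<le>d div 2. w k * folded f d k)"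
    unfolding sum.distrib[symmetric]
    by (intro sum.cong) (auto simp: folded_def algebra_simps)
  finally show ?thesis .
qed

lemma sum_middle:
  fixes f :: "nat \<Rightarrow> real"
  assumes "2 * j \<le> Suc d"
  shows "(\<Sum>k=j..d-j. f k) = (\<Sum>k=j..d div 2. folded f d k)"
proof -
  \<comment> \<open>The indicator of an interval that is symmetric under the reflection of
    \<open>k\<close> to \<open>d - k\<close>.\<close>
  define w :: "nat \<Rightarrow> real" where "w k = (if j \<le> k \<and> k \<le> d - j then 1 else 0)" for k
  have "(\<Sum>k=j..d-j. f k) = (\<Sum>k\<le>d. w k * f k)"
    unfolding w_def by (rule sum.mono_neutral_cong_left) auto
  also have "\<dots> = (\<Sum>k\<le>d div 2. w k * folded f d k)"
    using assms by (intro sum_symmetric_weights) (auto simp: w_def)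
  also have "\<dots> = (\<Sum>k=j..d div 2. folded f d k)"
    unfolding w_def using assms by (intro sum.mono_neutral_cong_right) auto
  finally show ?thesis .
qed

text \<open>The mixed counterpart of \<^term>\<open>folded\<close>, palindromic of degree \<open>d + 1\<close> instead of \<open>d\<close>.\<close>

definition mixed :: "real \<Rightarrow> nat \<Rightarrow> nat \<Rightarrow> real" where
  "mixed t d j = t * eulerian t d j + eulerian t d (d - j)"

text \<open>The range splits into the first \<open>j\<close>, the middle and the last
  \<open>j\<close> indices. Passing from \<open>j\<close> to \<open>Suc d - j\<close> changes the
  weight of the middle from 1 to \<open>t\<close>.\<close>

lemma eulerian_split:
  fixes t :: real and d j :: nat
  assumes "2 * j \<le> Suc d"
  defines "P \<equiv> \<Sum>k<j. eulerian t d k" and "Q \<equiv> \<Sum>k<j. eulerian t d (d - k)"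
    and "M \<equiv> \<Sum>k=j..d-j. eulerian t d k"
  shows "eulerian t (Suc d) j = t * P + M + Q"
    "eulerian t (Suc d) (Suc d - j) = t * P + t * M + Q"
proof -
  have Q: "(\<Sum>k=Suc d - j..d. eulerian t d k) = Q"
    unfolding Q_def
    by (rule sum.reindex_bij_witness[of _ "\<lambda>k. d - k" "\<lambda>k. d - k"]) (use assms(1) in auto)
  have eq: "{j..d} = {j..d-j} \<union> {Suc d - j..d}"
    using assms(1) by auto
  have "(\<Sum>k=j..d. eulerian t d k) = M + (\<Sum>k=Suc d - j..d. eulerian t d k)"
    unfolding M_def eq by (rule sum.union_disjoint) auto
  then show "eulerian t (Suc d) j = t * P + M + Q"
    by (simp add: P_def Q)
  have eq: "{..<Suc d - j} = {..<j} \<union> {j..d-j}"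
    using assms(1) by auto
  have "(\<Sum>k<Suc d - j. eulerian t d k) = P + M"
    unfolding M_def P_def eq by (rule sum.union_disjoint) auto
  then show "eulerian t (Suc d) (Suc d - j) = t * P + t * M + Q"
    by (simp add: Q algebra_simps)
qed

lemma sum_mixed:
  "(\<Sum>k<j. mixed t d k) = t * (\<Sum>k<j. eulerian t d k) + (\<Sum>k<j. eulerian t d (d - k))"
  by (simp add: mixed_def sum.distrib sum_distrib_left)

text \<open>Adding the two equations of \<open>eulerian_split\<close> doubles the outer blocks and
  gives the middle weight \<open>1 + t\<close>. If \<open>2 * j = Suc d\<close>, the middle is empty
  and the two equations coincide, so one is taken.\<close>

lemma folded_eulerian_Suc:
  assumes "2 * j \<le> Suc d"
  shows "folded (eulerian t (Suc d)) (Suc d) j =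
    (if 2 * j = Suc d then (\<Sum>k<j. mixed t d k)
     else 2 * (\<Sum>k<j. mixed t d k) + (1 + t) * (\<Sum>k=j..d div 2. folded (eulerian t d) d k))"
proof (cases "2 * j = Suc d")
  case True
  then have "{j..d-j} = {}"
    by auto
  then show ?thesis
    using eulerian_split(1)[OF assms, of t] True by (simp add: folded_def sum_mixed del: eulerian.simps)
next
  case False
  then show ?thesis
    using eulerian_split[OF assms, of t] sum_middle[OF assms, of "eulerian t d"]
    by (simp add: folded_def sum_mixed algebra_simps del: eulerian.simps)
qed

text \<open>With \<open>t\<close> times the first equation of \<open>eulerian_split\<close> plus the
  second, the outer blocks get weight \<open>1 + t\<close> and the middle
  \<open>2 * t\<close>.\<close>

lemma mixed_Suc:
  assumes "2 * j \<le> Suc d"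
  shows "mixed t (Suc d) j =
    (1 + t) * (\<Sum>k<j. mixed t d k) + 2 * t * (\<Sum>k=j..d div 2. folded (eulerian t d) d k)"
  unfolding mixed_def[of t "Suc d"] eulerian_split[OF assms, of t] sum_mixed
    sum_middle[OF assms, of "eulerian t d", symmetric]
  by (simp add: algebra_simps)

lemma face_sums_concat: "face_sums x (concat (map f ks)) = (\<Sum>k\<leftarrow>ks. face_sums x (f k))"
  by (induction ks) auto

lemma face_sums_blinks: "face_sums x (concat (map (blinks d) [i..<j])) = (\<Sum>k=i..<j. face_sums x (blinks d k))"
  unfolding face_sums_concat by (simp add: interv_sum_list_conv_sum_set_nat)

lemma face_sums_alinks_from: "face_sums x (alinks_from d j) = (\<Sum>k=j..d div 2. face_sums x (alinks d k))"
  unfolding face_sums_concat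
  by (simp add: interv_sum_list_conv_sum_set_nat atLeastLessThanSuc_atLeastAtMost rev_map[symmetric] del: upt_Suc)

lemma face_sum_attach_alinks:
  assumes "1 \<le> j"
  shows "face_sum x (attach_cones d (skel d) (alinks_from d j)) =
    face_sum x (skel d) + x * face_sums x (alinks_from d j)"
proof (rule face_sum_attach_cones[OF levelled_skel])
  fix G assume "G \<in> set (alinks_from d j)"
  then obtain k where "j \<le> k" "k \<le> d div 2" "G \<in> set (alinks d k)"
    by (auto simp del: upt_Suc)
  moreover from this have "1 \<le> k" "2 * k \<le> d"
    using assms by linarith+
  ultimately show "G \<subseteq> skel d"
    using alinks_subset(2) by simp
qed

text \<open>Joint induction along the two recursions. Writing \<open>t\<close> as
  \<open>x * (1 + t) ^ 2\<close> turns the factor \<open>2 * t\<close> of \<open>mixed_Suc\<close>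
  into the factor \<open>x\<close> that attached cones carry.\<close>

lemma eulerian_face_sums:
  fixes t :: real
  assumes t: "1 + t \<noteq> 0"
  defines "x \<equiv> t / (1 + t)\<^sup>2"
  shows "folded (eulerian t d) d 0 = (1 + t) ^ d * face_sum x (skel d) \<and>
    (\<forall>j. 1 \<le> j \<and> 2 * j \<le> d \<longrightarrow> folded (eulerian t d) d j = (1 + t) ^ d * (x * face_sums x (alinks d j))) \<and>
    (\<forall>j. 1 \<le> d \<and> 2 * j \<le> d \<longrightarrow> mixed t d j = (1 + t) ^ Suc d * (x * face_sums x (blinks d j)))"
proof (induction d)
  case 0
  show ?case
    by (simp add: folded_def face_sum_def)
next
  case (Suc d)
  note IH = Suc.IH[THEN conjunct1] Suc.IH[THEN conjunct2, THEN conjunct1] Suc.IH[THEN conjunct2, THEN conjunct2]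
  let ?M = "\<lambda>j. \<Sum>k=j..d div 2. folded (eulerian t d) d k"
  let ?B = "\<lambda>j. concat (map (blinks d) [0..<j])"
  have M: "?M j = (1 + t) ^ d * (x * face_sums x (alinks_from d j))" if "1 \<le> j" for j
    unfolding face_sums_alinks_from sum_distrib_left
  proof (rule sum.cong)
    fix k assume "k \<in> {j..d div 2}"
    then have "1 \<le> k" "2 * k \<le> d"
      using that by auto
    then show "folded (eulerian t d) d k = (1 + t) ^ d * (x * face_sums x (alinks d k))"
      using IH(2) by blast
  qed simp
  \<comment> \<open>The summand of index 0 has no factor \<open>x\<close>: it is the base complex
    \<open>skel d\<close>, and the other summands are the cones attached to it.\<close>
  have "?M 0 = folded (eulerian t d) d 0 + ?M 1"
    by (simp add: sum.atLeast_Suc_atMost)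
  then have M0: "?M 0 = (1 + t) ^ d * face_sum x (skel (Suc d))"
    using IH(1) M[of 1] face_sum_attach_alinks[of 1 x d] by (simp add: algebra_simps del: upt_Suc)
  have B: "(\<Sum>k<j. mixed t d k) = (1 + t) ^ Suc d * (x * face_sums x (?B j))"
    if "1 \<le> j" "2 * j \<le> Suc d" for j
    unfolding face_sums_blinks sum_distrib_left atLeast0LessThan[symmetric]
  proof (rule sum.cong)
    fix k assume "k \<in> {0..<j}"
    then have "1 \<le> d" "2 * k \<le> d"
      using that by auto
    then show "mixed t d k = (1 + t) ^ Suc d * (x * face_sums x (blinks d k))"
      using IH(3) by blast
  qed simp
  have a0: "folded (eulerian t (Suc d)) (Suc d) 0 = (1 + t) ^ Suc d * face_sum x (skel (Suc d))"
    using folded_eulerian_Suc[of 0 d t] M0 by (simp del: skel.simps eulerian.simps)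
  have a: "folded (eulerian t (Suc d)) (Suc d) j = (1 + t) ^ Suc d * (x * face_sums x (alinks (Suc d) j))"
    if j: "1 \<le> j" "2 * j \<le> Suc d" for j
    unfolding folded_eulerian_Suc[OF j(2)] M[OF j(1)] B[OF j]
    by (simp add: algebra_simps del: upt_Suc)
  have x: "x * (1 + t)\<^sup>2 = t"
    using t by (simp add: x_def)
  have b: "mixed t (Suc d) j = (1 + t) ^ Suc (Suc d) * (x * face_sums x (blinks (Suc d) j))"
    if j: "2 * j \<le> Suc d" for j
  proof (cases "j = 0")
    case True
    have "mixed t (Suc d) 0 = 2 * (x * (1 + t)\<^sup>2) * ((1 + t) ^ d * face_sum x (skel (Suc d)))"
      unfolding x using mixed_Suc[of 0 d t] M0 by (simp del: skel.simps)
    then show ?thesis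
      unfolding True by (simp add: power2_eq_square algebra_simps numeral_2_eq_2 del: skel.simps)
  next
    case False
    then have j1: "1 \<le> j"
      by simp
    have "d \<ge> 1"
      using j j1 by linarith
    then obtain e where e: "d = Suc e"
      by (cases d) auto
    \<comment> \<open>Index 0 contributes two copies of \<open>skel d\<close>. Together with twice
      the cones over \<open>alinks_from d j\<close> they form the two complexes at the head of
      \<open>blinks (Suc d) j\<close>.\<close>
    have "[0..<j] = 0 # [1..<j]"
      using j1 by (simp add: upt_rec)
    then have B': "face_sums x (?B j) = 2 * face_sum x (skel d) + face_sums x (concat (map (blinks d) [1..<j]))"
      unfolding e by (simp add: numeral_2_eq_2 del: skel.simps)
    have "mixed t (Suc d) j = (1 + t) * ((1 + t) ^ Suc d * (x * face_sums x (?B j))) +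
        2 * (x * (1 + t)\<^sup>2) * ((1 + t) ^ d * (x * face_sums x (alinks_from d j)))"
      unfolding x using mixed_Suc[OF j, of t] M[OF j1] B[OF j1 j] by simp
    also have "\<dots> = (1 + t) ^ Suc (Suc d) * (x * (face_sums x (?B j) + 2 * (x * face_sums x (alinks_from d j))))"
      by (simp add: power2_eq_square algebra_simps del: upt_Suc)
    also have "face_sums x (?B j) + 2 * (x * face_sums x (alinks_from d j)) = face_sums x (blinks (Suc d) j)"
      using j1 face_sum_attach_alinks[OF j1, of x d] unfolding B'
      by (simp add: numeral_2_eq_2 del: upt_Suc)
    finally show ?thesis .
  qed
  have "\<forall>j. 1 \<le> j \<and> 2 * j \<le> Suc d \<longrightarrow> folded (eulerian t (Suc d)) (Suc d) j =
      (1 + t) ^ Suc d * (x * face_sums x (alinks (Suc d) j))"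
    using a by (intro allI impI, elim conjE)
  moreover have "\<forall>j. 1 \<le> Suc d \<and> 2 * j \<le> Suc d \<longrightarrow>
      mixed t (Suc d) j = (1 + t) ^ Suc (Suc d) * (x * face_sums x (blinks (Suc d) j))"
    using b by (intro allI impI, elim conjE)
  ultimately show ?case
    using a0 by (intro conjI)
qed

section \<open>The \<open>\<gamma>\<close>-vector of the subdivision\<close>

lemma colour_less:
  assumes "levelled (Suc d) K" "S \<in> K" "v \<in> S"
  shows "colour v < d div 2"
proof -
  have "2 \<le> level v" "level v < Suc d"
    using assms unfolding levelled_def by auto
  then have "1 \<le> level v div 2" "level v div 2 \<le> d div 2"
    by linarith+
  then show ?thesis
    by (simp add: colour_def)
qed

lemma card_levelled_le:
  assumes "levelled (Suc d) K" "S \<in> K"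
  shows "card S \<le> d div 2"
proof -
  have "inj_on colour S"
    using assms unfolding levelled_def by simp
  moreover have "colour ` S \<subseteq> {..<d div 2}"
    using colour_less[OF assms] by auto
  ultimately show ?thesis
    using card_inj_on_le[of colour S "{..<d div 2}"] by simp
qed

text \<open>\<open>colour\<close> takes values below \<open>d div 2\<close>, and the face
  \<open>T\<close> shows that the dimension is large enough for this many colours.\<close>

lemma balanced_levelled:
  assumes K: "levelled (Suc d) K" and T: "T \<in> K" "card T = d div 2"
  shows "balanced K"
proof -
  have "finite K"
    using K unfolding levelled_def abstract_simplicial_complex_def by simp
  then have "d div 2 \<le> size_of card K"
    unfolding size_of_def using T by (metis Max_ge finite_imageI imageI)
  then have "\<forall>v\<in>\<Union>K. colour v < size_of card K"
    using colour_less[OF K] by fastforce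
  moreover have "\<forall>S\<in>K. inj_on colour S"
    using K unfolding levelled_def by simp
  ultimately show ?thesis
    unfolding balanced_def by blast
qed

lemma ex_balanced_complex:
  fixes h :: "nat \<Rightarrow> nat"
  assumes h0: "h 0 = 1"
  obtains K where "abstract_simplicial_complex K" "balanced K" "\<And>S. S \<in> K \<Longrightarrow> card S \<le> d div 2"
    "\<And>t. 1 + t \<noteq> 0 \<Longrightarrow> (\<Sum>j\<le>d div 2. real (h j) * folded (eulerian t d) d j) =
       (1 + t) ^ d * face_sum (t / (1 + t)\<^sup>2) K"
proof -
  \<comment> \<open>Each link of index \<open>j\<close> is listed \<open>h j\<close> times. Index 0
    is left out because \<open>h 0 = 1\<close> is accounted for by the base complex
    \<open>skel d\<close>.\<close>
  define Gs where "Gs = concat (map (\<lambda>j. concat (replicate (h j) (alinks d j))) [1..<Suc (d div 2)])"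
  define K where "K = attach_cones d (skel d) Gs"
  have Gs: "\<exists>j. 1 \<le> j \<and> 2 * j \<le> d \<and> h j > 0 \<and> G \<in> set (alinks d j)" if G: "G \<in> set Gs" for G
  proof -
    obtain j where "1 \<le> j" "j \<le> d div 2" "h j > 0" "G \<in> set (alinks d j)"
      using G by (auto simp: Gs_def simp del: upt_Suc)
    then show ?thesis
      by (intro exI[of _ j]) auto
  qed
  have sub: "levelled (d - 1) G \<and> G \<subseteq> skel d" if "G \<in> set Gs" for G
    using Gs[OF that] alinks_subset by blast
  have d: "d \<ge> 2" if nonempty: "Gs \<noteq> []"
  proof -
    obtain j where "1 \<le> j" "2 * j \<le> d"
      using Gs[of "hd Gs"] nonempty by auto
    then show ?thesis
      by simp
  qed
  have K: "levelled (Suc d) K"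
    unfolding K_def by (rule levelled_attach_cones[OF levelled_skel d sub])
  have balanced: "balanced K"
  proof (cases "Gs = []")
    case True
    then have "K = skel d"
      by (simp add: K_def attach_cones_def)
    \<comment> \<open>Without cones no vertex has level \<open>d\<close>, so
      \<open>(d - 1) div 2\<close> colours suffice, matching the face from
      \<open>skel_large_face\<close>.\<close>
    moreover have "levelled (Suc (d - 1)) (skel d)"
      by (rule levelled_mono[OF levelled_skel]) simp
    moreover obtain T where "T \<in> skel d" "card T = (d - 1) div 2"
      using skel_large_face by blast
    ultimately show ?thesis
      using balanced_levelled[of "d - 1" "skel d" T] by simp
  next
    case False
    then obtain j where j: "1 \<le> j" "2 * j \<le> d" "h j > 0"
      using Gs[of "hd Gs"] by auto
    \<comment> \<open>The cone over this link has a face with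
      \<open>(d - 2) div 2 + 1 = d div 2\<close> vertices, one for each colour.\<close>
    have mem: "skel (d - 1) \<in> set Gs"
      unfolding Gs_def using j skel_in_alinks[OF j(1,2)]
      by (auto simp del: upt_Suc intro!: bexI[of _ j])
    obtain S where S: "S \<in> skel (d - 1)" "card S = (d - 1 - 1) div 2"
      using skel_large_face by blast
    have "skel (d - 1) \<subseteq> skel d"
      using sub[OF mem] by simp
    then obtain T where T: "T \<in> K" "card T = Suc (card S)"
      using attach_cones_card[OF levelled_skel mem _ S(1)] unfolding K_def by blast
    have "card T = d div 2"
      unfolding T(2) S(2) using d[OF False] by simp
    then show ?thesis
      by (rule balanced_levelled[OF K T(1)])
  qed
  have sum: "(\<Sum>j\<le>d div 2. real (h j) * folded (eulerian t d) d j) =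
      (1 + t) ^ d * face_sum (t / (1 + t)\<^sup>2) K" if t: "1 + t \<noteq> 0" for t
  proof -
    let ?x = "t / (1 + t)\<^sup>2"
    have "face_sums ?x (concat (replicate n Hs)) = real n * face_sums ?x Hs" for n Hs
      by (induction n) (auto simp: algebra_simps)
    then have Gs_sum: "face_sums ?x Gs = (\<Sum>j=1..d div 2. real (h j) * face_sums ?x (alinks d j))"
      unfolding Gs_def face_sums_concat
      by (simp add: interv_sum_list_conv_sum_set_nat atLeastLessThanSuc_atLeastAtMost del: upt_Suc)
    have "(\<Sum>j\<le>d div 2. real (h j) * folded (eulerian t d) d j) =
        folded (eulerian t d) d 0 + (\<Sum>j=1..d div 2. real (h j) * folded (eulerian t d) d j)"
      by (simp add: atMost_atLeast0 sum.atLeast_Suc_atMost h0)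
    also have "folded (eulerian t d) d 0 = (1 + t) ^ d * face_sum ?x (skel d)"
      using eulerian_face_sums[OF t] by simp
    also have "(\<Sum>j=1..d div 2. real (h j) * folded (eulerian t d) d j) =
        (\<Sum>j=1..d div 2. (1 + t) ^ d * ?x * (real (h j) * face_sums ?x (alinks d j)))"
    proof (rule sum.cong)
      fix j assume "j \<in> {1..d div 2}"
      then have "folded (eulerian t d) d j = (1 + t) ^ d * (?x * face_sums ?x (alinks d j))"
        using eulerian_face_sums[OF t, of d] by auto
      then show "real (h j) * folded (eulerian t d) d j =
          (1 + t) ^ d * ?x * (real (h j) * face_sums ?x (alinks d j))"
        by (simp only: mult_ac)
    qed simp
    also have "\<dots> = (1 + t) ^ d * ?x * face_sums ?x Gs"
      unfolding Gs_sum sum_distrib_left ..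
    also have "(1 + t) ^ d * face_sum ?x (skel d) + \<dots> = (1 + t) ^ d * face_sum ?x K"
      unfolding K_def using face_sum_attach_cones[OF levelled_skel, of Gs d ?x] sub
      by (simp add: distrib_left mult.assoc)
    finally show ?thesis .
  qed
  have "abstract_simplicial_complex K"
    using K unfolding levelled_def by simp
  then show thesis
    using balanced card_levelled_le[OF K] sum by (rule that)
qed

section \<open>Translation to \<open>f\<close>-, \<open>h\<close>- and
  \<open>\<gamma>\<close>-vectors\<close>

lemma face_sum_f_vec:
  assumes "finite K" "\<And>S. S \<in> K \<Longrightarrow> card S \<le> m"
  shows "face_sum x K = (\<Sum>i\<le>m. real (f_vec card K i) * x ^ i)"
proof -
  have "face_sum x K = (\<Sum>i\<le>m. \<Sum>S | S \<in> K \<and> card S = i. x ^ card S)"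
    unfolding face_sum_def using assms by (intro sum.group[symmetric]) auto
  also have "\<dots> = (\<Sum>i\<le>m. real (f_vec card K i) * x ^ i)"
    by (simp add: f_vec_def)
  finally show ?thesis .
qed

text \<open>Up to the common factor \<open>(1 + t) ^ d\<close>, each basis polynomial is a power of
  \<open>t / (1 + t) ^ 2\<close>; in this variable the expansion can be compared with an
  \<open>f\<close>-polynomial.\<close>

lemma poly_gamma_expansion:
  assumes t: "1 + t \<noteq> 0"
  shows "poly (gamma_expansion d g) t = (1 + t) ^ d * (\<Sum>i\<le>d div 2. g i * (t / (1 + t)\<^sup>2) ^ i)"
proof -
  have "poly (gamma_expansion d g) t = (\<Sum>i\<le>d div 2. g i * (t ^ i * (1 + t) ^ (d - 2 * i)))"
    by (simp add: gamma_expansion_def poly_sum poly_monom)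
  also have "\<dots> = (\<Sum>i\<le>d div 2. (1 + t) ^ d * (g i * (t / (1 + t)\<^sup>2) ^ i))"
  proof (rule sum.cong)
    fix i assume "i \<in> {..d div 2}"
    then have "(1 + t) ^ (d - 2 * i) = (1 + t) ^ d / (1 + t) ^ (2 * i)"
      using t by (intro power_diff) auto
    then show "g i * (t ^ i * (1 + t) ^ (d - 2 * i)) = (1 + t) ^ d * (g i * (t / (1 + t)\<^sup>2) ^ i)"
      by (simp add: power_divide power_mult)
  qed simp
  finally show ?thesis
    by (simp add: sum_distrib_left)
qed

lemma gamma_expansion_symmetric:
  "degree (gamma_expansion d g) \<le> d"
  "i \<le> d \<Longrightarrow> coeff (gamma_expansion d g) i = coeff (gamma_expansion d g) (d - i)"
proof -
  have c: "coeff (gamma_expansion d g) i =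
      (\<Sum>k\<le>d div 2. g k * (if i < k then 0 else real ((d - 2 * k) choose (i - k))))" for i
    unfolding gamma_expansion_def coeff_sum
    by (rule sum.cong) (auto simp: coeff_monom_mult coeff_one_plus_X_power)
  show "degree (gamma_expansion d g) \<le> d"
  proof (rule degree_le, intro allI impI)
    fix i assume "d < i"
    then show "coeff (gamma_expansion d g) i = 0"
      unfolding c by (intro sum.neutral) (auto simp: binomial_eq_0)
  qed
  show "coeff (gamma_expansion d g) i = coeff (gamma_expansion d g) (d - i)" if i: "i \<le> d"
    unfolding c
  proof (rule sum.cong)
    fix k assume k: "k \<in> {..d div 2}"
    have "(if i < k then 0 else real ((d - 2 * k) choose (i - k))) =
        (if d - i < k then 0 else real ((d - 2 * k) choose (d - i - k)))"
    proof (cases "i < k \<or> d - i < k")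
      case True
      then show ?thesis
        using k i by (auto simp: binomial_eq_0)
    next
      case False
      then have "(d - 2 * k) choose (i - k) = (d - 2 * k) choose (d - 2 * k - (i - k))"
        using i k by (intro binomial_symmetric) auto
      moreover have "d - 2 * k - (i - k) = d - i - k"
        using False i k by auto
      ultimately show ?thesis
        using False by simp
    qed
    then show "g k * (if i < k then 0 else real ((d - 2 * k) choose (i - k))) =
        g k * (if d - i < k then 0 else real ((d - 2 * k) choose (d - i - k)))"
      by simp
  qed simp
qed

text \<open>Integrality, together with nonnegativity, lets an entry of the \<open>h\<close>-vector
  serve as a number of copies of cones.\<close>

lemma h_vec_Ints:
  assumes "finite D"
  shows "h_vec \<rho> D j \<in> \<int>"
proof -
  have "coeff ([:1, -1:] ^ m :: real poly) i \<in> \<int>" for m i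
    by (induction m arbitrary: i) (auto simp: coeff_pCons split: nat.split)
  then show ?thesis
    unfolding h_vec_def h_poly_eq[OF assms]
    by (auto simp: coeff_sum coeff_monom_mult intro!: Ints_sum)
qed

lemma h_vec_0:
  assumes "finite D"
  shows "h_vec \<rho> D 0 = real (f_vec \<rho> D 0)"
proof -
  have "h_vec \<rho> D 0 = (\<Sum>F\<in>D. 0 ^ \<rho> F)"
    unfolding h_vec_def poly_0_coeff_0[symmetric] h_poly_char[OF assms, of 0, simplified]
    by (simp add: f_poly_def poly_sum poly_monom)
  also have "\<dots> = (\<Sum>F\<in>D. if \<rho> F = 0 then 1 else 0)"
    by (intro sum.cong) auto
  also have "\<dots> = real (f_vec \<rho> D 0)"
    using assms by (simp add: f_vec_def sum.If_cases Int_def)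
  finally show ?thesis .
qed

theorem theorem1p3:
  fixes X :: "'a topology" and C :: "'a set set"
  assumes "boolean_cell_complex X C"
    and "\<forall>i\<le>size_of (face_rank X) (faces C). h_vec (face_rank X) (faces C) i \<ge> 0"
    and "h_symmetric (face_rank X) (faces C)"
  shows "h_symmetric card (barycentric_subdivision X C) \<and>
    (\<exists>K :: nat set set. abstract_simplicial_complex K \<and> balanced K \<and>
       (\<forall>i. gamma_vec card (barycentric_subdivision X C) i = real (f_vec card K i)))"
proof -
  interpret boolean_intervals "faces C" "face_le X" "{}"
    using assms(1) by (rule boolean_cell_complex_intervals)
  let ?\<rho> = "face_rank X" and ?P = "faces C"
  let ?h = "h_vec ?\<rho> ?P"
  define d where "d = size_of ?\<rho> ?P"
  have rank: "?\<rho> F = rank F" if "F \<in> ?P" for F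
    using face_rank_eq[OF assms(1) that] .
  have sd: "barycentric_subdivision X C = chains"
    using barycentric_subdivision_eq[OF assms(1)] .
  have "?\<rho> ` ?P = rank ` ?P"
    using rank by (rule image_cong[OF refl])
  then have size_sd: "size_of card chains = d"
    unfolding d_def size_of_chains by (simp only: size_of_def)
  define h where "h j = nat \<lfloor>?h j\<rfloor>" for j
  have h: "real (h j) = ?h j" if "j \<le> d" for j
  proof -
    have "0 \<le> ?h j" "?h j \<in> \<int>"
      using assms(2) that h_vec_Ints[OF finite_P] by (auto simp: d_def)
    then show ?thesis
      by (auto simp: h_def elim!: Ints_cases)
  qed
  have "{F \<in> ?P. ?\<rho> F = 0} = {{}}"
    using bot_P by (auto simp: face_rank_def)
  then have "?h 0 = 1"
    by (simp add: h_vec_0[OF finite_P] f_vec_def)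
  then have "h 0 = 1"
    by (simp add: h_def)
  then obtain K where K: "abstract_simplicial_complex K" "balanced K" "\<And>S. S \<in> K \<Longrightarrow> card S \<le> d div 2"
    "\<And>t. 1 + t \<noteq> 0 \<Longrightarrow> (\<Sum>j\<le>d div 2. real (h j) * folded (eulerian t d) d j) =
       (1 + t) ^ d * face_sum (t / (1 + t)\<^sup>2) K"
    using ex_balanced_complex[of h d] by blast
  have finite_K: "finite K"
    using K(1) unfolding abstract_simplicial_complex_def by simp
  define g where "g i = real (f_vec card K i)" for i
  have g0: "\<forall>i > d div 2. g i = 0"
  proof (intro allI impI)
    fix i assume "d div 2 < i"
    then have "{S \<in> K. card S = i} = {}"
      using K(3) leD by auto
    then show "g i = 0"
      unfolding g_def f_vec_def by (simp only: card.empty of_nat_0)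
  qed
  \<comment> \<open>On this interval neither \<open>1 - t\<close> nor \<open>1 + t\<close> vanishes,
    and its infinitely many points determine the polynomials.\<close>
  have "poly (h_poly card chains) t = poly (gamma_expansion d g) t" if t: "0 < t" "t < 1" for t
  proof -
    have "poly (h_poly card chains) t = (1 - t) ^ d * (\<Sum>S\<in>chains. (t / (1 - t)) ^ card S)"
      using h_poly_char[OF finite_chains, of t card] t
      by (simp add: size_sd f_poly_def poly_sum poly_monom)
    \<comment> \<open>\<open>sum_chains\<close> with \<open>s = t / (1 - t)\<close> and
      \<open>g n = eulerian t n n / (1 - t) ^ n\<close>.\<close>
    also have "(\<Sum>S\<in>chains. (t / (1 - t)) ^ card S) =
        (\<Sum>F\<in>?P. eulerian t (rank F) (rank F) / (1 - t) ^ rank F)"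
      by (rule sum_chains) (use eulerian_diag t in auto)
    also have "(1 - t) ^ d * \<dots> = (\<Sum>F\<in>?P. (1 - t) ^ (d - ?\<rho> F) * eulerian t (?\<rho> F) (?\<rho> F))"
      unfolding sum_distrib_left
    proof (rule sum.cong)
      fix F assume F: "F \<in> ?P"
      then have "?\<rho> F \<le> d"
        unfolding d_def size_of_def using finite_P by simp
      then show "(1 - t) ^ d * (eulerian t (rank F) (rank F) / (1 - t) ^ rank F) =
          (1 - t) ^ (d - ?\<rho> F) * eulerian t (?\<rho> F) (?\<rho> F)"
        using t rank[OF F] by (simp add: power_diff)
    qed simp
    also have "\<dots> = (\<Sum>j\<le>d. ?h j * eulerian t d j)"
      using sum_h_vec_eulerian[OF finite_P, of ?\<rho> t] by (simp add: d_def)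
    \<comment> \<open>The symmetry of the \<open>h\<close>-vector enters here and pairs
      \<open>j\<close> with \<open>d - j\<close>.\<close>
    also have "\<dots> = (\<Sum>j\<le>d div 2. ?h j * folded (eulerian t d) d j)"
    proof (rule sum_symmetric_weights)
      show "?h (d - k) = ?h k" if "k \<le> d" for k
        using assms(3)[unfolded h_symmetric_def, rule_format, of k] that by (metis d_def)
    qed
    also have "\<dots> = (\<Sum>j\<le>d div 2. real (h j) * folded (eulerian t d) d j)"
      using h by (intro sum.cong) auto
    also have "\<dots> = (1 + t) ^ d * face_sum (t / (1 + t)\<^sup>2) K"
      using K(4) t by simp
    also have "\<dots> = poly (gamma_expansion d g) t"
      using t by (subst poly_gamma_expansion) (auto simp: face_sum_f_vec[OF finite_K K(3)] g_def)
    finally show ?thesis .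
  qed
  then have "{0<..<1} \<subseteq> {t. poly (h_poly card chains - gamma_expansion d g) t = 0}"
    by auto
  then have "infinite {t. poly (h_poly card chains - gamma_expansion d g) t = 0}"
    by (rule infinite_super) (simp add: infinite_Ioo)
  then have h_poly: "h_poly card chains = gamma_expansion d g"
    using poly_roots_finite[of "h_poly card chains - gamma_expansion d g"] by auto
  have "gamma_vec card chains = g"
    unfolding gamma_vec_def size_sd
  proof (rule the1_equality)
    show "\<exists>!g. (\<forall>i > d div 2. g i = 0) \<and> h_poly card chains = gamma_expansion d g"
      unfolding h_poly by (rule gamma_expansion_ex1[OF gamma_expansion_symmetric])
    show "(\<forall>i > d div 2. g i = 0) \<and> h_poly card chains = gamma_expansion d g"
      using g0 h_poly by blast
  qed
  moreover have "h_symmetric card chains"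
    unfolding h_symmetric_def size_sd h_vec_def h_poly
    by (intro allI impI gamma_expansion_symmetric(2))
  ultimately show ?thesis
    unfolding sd using K(1,2) by (auto simp: g_def)
qed

end
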